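(* The topological realization of the projective Fraïssé limit of the family $\mathcal{T}_{\mathcal{M}3}$ is homeomorphic to the Ważewski dendrite $D_3$.
   Context: A graph is a pair $A=(V(A),E(A))$ with $E(A)\subseteq V(A)^2$ reflexive and symmetric. An epimorphism is a map on vertices sending edges to edges that is surjective on vertices and on edges. A topological graph is a graph whose vertex set is compact, zero-dimensional, second-countable and whose edge set is closed; epimorphisms between them are continuous. A subset $S\subseteq V(G)$ is disconnected if $S=P\cup Q$ with $P,Q$ nonempty disjoint closed and no edge between $P$ and $Q$; otherwise connected. An epimorphism is monotone if preimages of closed connected sets are connected. A tree is a finite graph in which any two distinct vertices are joined by a unique path of pairwise distinct vertices; the order of a vertex is the number of non-degenerate edges containing it. $\mathcal{T}_{\mathcal{M}3}$ is the class of trees with at least two vertices, all of order $\le 3$, with all monotone epimorphisms; it is a projective Fraïssé family (countably many isomorphism types, closure under composition and identities, joint projection and amalgamation properties). The projective Fraïssé limit of such a family $\mathcal F$ is the unique topological graph $\mathbb F$ which is an inverse limit $\varprojlim\{F_n,\alpha_n\}$ of members of $\mathcal F$ with bonding maps in the family (edges coordinatewise) such that (i) every $A\in\mathcal F$ is the image of $\mathbb F$ under some admissible epimorphism, and (ii) for admissible $f\colon \mathbb F\to A$ and $g\colon B\to A$ in the family there is admissible $h\colon\mathbb F\to B$ with $f=g\circ h$; here an epimorphism $\mathbb F\to A$ is admissible iff it is of the form $h'\circ\alpha^\infty_m$ with $h'\colon F_m\to A$ in the family and $\alpha_m^\infty$ the projection. The edge relation of this limit is transitive, and its topological realization is the quotient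 space $V(\mathbb F)/E(\mathbb F)$. The Ważewski dendrite $D_3$ is the (unique up to homeomorphism) dendrite in which every ramification point has order $3$ and the set of ramification points is dense. *)

theory Defs
  imports "HOL-Analysis.Analysis"
begin

type_synonym fgraph = "nat set \<times> (nat \<times> nat) set"

definition is_graph :: "'a set \<times> ('a \<times> 'a) set \<Rightarrow> bool" where
  "is_graph G \<longleftrightarrow> snd G \<subseteq> fst G \<times> fst G
      \<and> (\<forall>v\<in>fst G. (v, v) \<in> snd G)
      \<and> (\<forall>u v. (u, v) \<in> snd G \<longrightarrow> (v, u) \<in> snd G)"

text \<open>Epimorphism: vertex map sending edges to edges, surjective on vertices and on edges.
  Maps are only relevant on the vertex set of the domain.\<close>
definition is_epi :: "'a set \<times> ('a \<times> 'a) set \<Rightarrow> 'b set \<times> ('b \<times> 'b) set \<Rightarrow> ('a \<Rightarrow> 'b) \<Rightarrow> bool" where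
  "is_epi G H f \<longleftrightarrow> f ` fst G = fst H
      \<and> (\<forall>x y. (x, y) \<in> snd G \<longrightarrow> (f x, f y) \<in> snd H)
      \<and> (\<forall>u v. (u, v) \<in> snd H \<longrightarrow> (\<exists>x y. (x, y) \<in> snd G \<and> f x = u \<and> f y = v))"

text \<open>Connectedness of a subset of a finite graph (every subset is closed in the discrete
  topology of a finite graph).\<close>
definition graph_connected_set :: "'a set \<times> ('a \<times> 'a) set \<Rightarrow> 'a set \<Rightarrow> bool" where
  "graph_connected_set G S \<longleftrightarrow>
     \<not> (\<exists>P Q. S = P \<union> Q \<and> P \<noteq> {} \<and> Q \<noteq> {} \<and> P \<inter> Q = {}
             \<and> (\<forall>p\<in>P. \<forall>q\<in>Q. (p, q) \<notin> snd G))"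

definition is_monotone_epi :: "'a set \<times> ('a \<times> 'a) set \<Rightarrow> 'b set \<times> ('b \<times> 'b) set \<Rightarrow> ('a \<Rightarrow> 'b) \<Rightarrow> bool" where
  "is_monotone_epi G H f \<longleftrightarrow> is_epi G H f
      \<and> (\<forall>S. S \<subseteq> fst H \<longrightarrow> graph_connected_set H S
              \<longrightarrow> graph_connected_set G {x \<in> fst G. f x \<in> S})"

definition is_path :: "'a set \<times> ('a \<times> 'a) set \<Rightarrow> 'a \<Rightarrow> 'a \<Rightarrow> 'a list \<Rightarrow> bool" where
  "is_path G a b p \<longleftrightarrow> p \<noteq> [] \<and> hd p = a \<and> last p = b \<and> distinct p
      \<and> set p \<subseteq> fst G
      \<and> (\<forall>i. Suc i < length p \<longrightarrow> (p ! i, p ! Suc i) \<in> snd G)"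

definition is_tree :: "'a set \<times> ('a \<times> 'a) set \<Rightarrow> bool" where
  "is_tree G \<longleftrightarrow> is_graph G \<and> finite (fst G)
      \<and> (\<forall>a\<in>fst G. \<forall>b\<in>fst G. a \<noteq> b \<longrightarrow> (\<exists>!p. is_path G a b p))"

definition vertex_order :: "'a set \<times> ('a \<times> 'a) set \<Rightarrow> 'a \<Rightarrow> nat" where
  "vertex_order G v = card {w \<in> fst G. w \<noteq> v \<and> (v, w) \<in> snd G}"

text \<open>Members of the family T_M3 (up to isomorphism; vertices taken in nat).\<close>
definition TM3 :: "fgraph \<Rightarrow> bool" where
  "TM3 A \<longleftrightarrow> is_tree A \<and> 2 \<le> card (fst A) \<and> (\<forall>v\<in>fst A. vertex_order A v \<le> 3)"

definition inv_lim_vertices :: "(nat \<Rightarrow> fgraph) \<Rightarrow> (nat \<Rightarrow> nat \<Rightarrow> nat) \<Rightarrow> (nat \<Rightarrow> nat) set" where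
  "inv_lim_vertices F \<alpha> = {x. \<forall>n. x n \<in> fst (F n) \<and> \<alpha> n (x (Suc n)) = x n}"

definition inv_lim_edges :: "(nat \<Rightarrow> fgraph) \<Rightarrow> (nat \<Rightarrow> nat \<Rightarrow> nat) \<Rightarrow> ((nat \<Rightarrow> nat) \<times> (nat \<Rightarrow> nat)) set" where
  "inv_lim_edges F \<alpha> = {(x, y). x \<in> inv_lim_vertices F \<alpha> \<and> y \<in> inv_lim_vertices F \<alpha>
                              \<and> (\<forall>n. (x n, y n) \<in> snd (F n))}"

definition inv_lim_top :: "(nat \<Rightarrow> fgraph) \<Rightarrow> (nat \<Rightarrow> nat \<Rightarrow> nat) \<Rightarrow> (nat \<Rightarrow> nat) topology" where
  "inv_lim_top F \<alpha> = subtopology (product_topology (\<lambda>n. discrete_topology (fst (F n))) UNIV)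
                                   (inv_lim_vertices F \<alpha>)"

definition admissible :: "(nat \<Rightarrow> fgraph) \<Rightarrow> (nat \<Rightarrow> nat \<Rightarrow> nat) \<Rightarrow> fgraph \<Rightarrow> ((nat \<Rightarrow> nat) \<Rightarrow> nat) \<Rightarrow> bool" where
  "admissible F \<alpha> A f \<longleftrightarrow> TM3 A \<and>
     (\<exists>m h'. is_monotone_epi (F m) A h' \<and> (\<forall>x\<in>inv_lim_vertices F \<alpha>. f x = h' (x m)))"

definition is_proj_fraisse_limit_TM3 :: "(nat \<Rightarrow> fgraph) \<Rightarrow> (nat \<Rightarrow> nat \<Rightarrow> nat) \<Rightarrow> bool" where
  "is_proj_fraisse_limit_TM3 F \<alpha> \<longleftrightarrow>
     (\<forall>n. TM3 (F n) \<and> is_monotone_epi (F (Suc n)) (F n) (\<alpha> n))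
     \<and> (\<forall>A. TM3 A \<longrightarrow> (\<exists>f. admissible F \<alpha> A f))
     \<and> (\<forall>A B f g. admissible F \<alpha> A f \<longrightarrow> TM3 B \<longrightarrow> is_monotone_epi B A g \<longrightarrow>
          (\<exists>h. admissible F \<alpha> B h \<and> (\<forall>x\<in>inv_lim_vertices F \<alpha>. f x = g (h x))))"

definition quotient_top :: "'a topology \<Rightarrow> ('a \<Rightarrow> 'b) \<Rightarrow> 'b topology" where
  "quotient_top X q = topology (\<lambda>U. U \<subseteq> q ` topspace X \<and> openin X {x \<in> topspace X. q x \<in> U})"

lemma istopology_quotient:
  "istopology (\<lambda>U. U \<subseteq> q ` topspace X \<and> openin X {x \<in> topspace X. q x \<in> U})"
  unfolding istopology_def
proof (rule conjI; intro allI impI ballI)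
  fix S T assume "S \<subseteq> q ` topspace X \<and> openin X {x \<in> topspace X. q x \<in> S}"
     "T \<subseteq> q ` topspace X \<and> openin X {x \<in> topspace X. q x \<in> T}"
  moreover have "{x \<in> topspace X. q x \<in> S \<inter> T} = {x \<in> topspace X. q x \<in> S} \<inter> {x \<in> topspace X. q x \<in> T}"
    by auto
  ultimately show "S \<inter> T \<subseteq> q ` topspace X \<and> openin X {x \<in> topspace X. q x \<in> S \<inter> T}"
    by (metis (no_types, lifting) inf.coboundedI1 openin_Int)
next
  fix K assume K: "\<forall>S\<in>K. S \<subseteq> q ` topspace X \<and> openin X {x \<in> topspace X. q x \<in> S}"
  have "{x \<in> topspace X. q x \<in> \<Union>K} = (\<Union>S\<in>K. {x \<in> topspace X. q x \<in> S})" by auto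
  moreover have "openin X (\<Union>S\<in>K. {x \<in> topspace X. q x \<in> S})"
    using K by (intro openin_Union) auto
  ultimately show "\<Union>K \<subseteq> q ` topspace X \<and> openin X {x \<in> topspace X. q x \<in> \<Union>K}"
    using K by auto
qed

text \<open>Topological realization V(L)/E(L): the edge relation of the limit is an equivalence
  relation; each vertex is sent to its E-class.\<close>
definition realization :: "(nat \<Rightarrow> fgraph) \<Rightarrow> (nat \<Rightarrow> nat \<Rightarrow> nat) \<Rightarrow> (nat \<Rightarrow> nat) set topology" where
  "realization F \<alpha> = quotient_top (inv_lim_top F \<alpha>) (\<lambda>x. inv_lim_edges F \<alpha> `` {x})"

definition dendrite :: "'a topology \<Rightarrow> bool" where
  "dendrite X \<longleftrightarrow> topspace X \<noteq> {} \<and> compact_space X \<and> connected_space X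
      \<and> metrizable_space X \<and> locally_connected_space X
      \<and> \<not> (\<exists>S \<subseteq> topspace X. subtopology X S homeomorphic_space
                                top_of_set (sphere (0::complex) 1))"

definition comps_at :: "'a topology \<Rightarrow> 'a \<Rightarrow> 'a set set" where
  "comps_at X p = connected_components_of (subtopology X (topspace X - {p}))"

definition ramification_points :: "'a topology \<Rightarrow> 'a set" where
  "ramification_points X = {p \<in> topspace X. infinite (comps_at X p) \<or> 3 \<le> card (comps_at X p)}"

text \<open>D_3 is the unique (up to homeomorphism) dendrite whose ramification points all have
  order 3 and are dense; being homeomorphic to D_3 means having these properties.\<close>
definition wazewski_D3 :: "'a topology \<Rightarrow> bool" where
  "wazewski_D3 X \<longleftrightarrow> dendrite X
      \<and> (\<forall>p\<in>ramification_points X. finite (comps_at X p) \<and> card (comps_at X p) = 3)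
      \<and> X closure_of (ramification_points X) = topspace X"

end

theory Submission
  imports Defs
begin

text \<open>
  The limit enters only through two elementary surgeries on trees of order at most 3, subdividing an
  edge and attaching a leaf, whose collapsing maps factor through the inverse sequence. Subdividing
  edges shows that a thread has at most one other thread adjacent to it, so the edge relation is an
  equivalence. The images \<open>K n S\<close> of cylinders over connected vertex sets are subcontinua of the
  quotient and give local connectedness; Urysohn functions separating disjoint \<open>K n {v}\<close> and
  \<open>K n {w}\<close> give metrizability.

  If \<open>c k\<close> lies in every connected set of level \<open>k\<close> containing \<open>x k\<close> and \<open>y k\<close>, for all large \<open>k\<close>,
  then \<open>c\<close> separates \<open>x\<close> from \<open>y\<close> in the quotient. Any two points are separated in this way by the
  limit edge over some tree edge, whereas no point of a circle separates two others. Medians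
  of threads, which monotone maps preserve, produce a dense set of points with at least three
  complementary components. Conversely two points lying behind the same edge leaving the vertices
  of \<open>p\<close> at some level lie in the same component of the complement of \<open>p\<close>, and after a subdivision
  there are at most three such edges.
\<close>

section \<open>Finite trees\<close>

text \<open>Monotonicity speaks of preimages of connected sets, so paths are given up early: unique
  paths are traded for edge cuts, and betweenness is expressed by connected sets
  (\<open>interval\<close>), which pull back along bonding maps. The obstacle in the quotient is
  that a point may consist of two adjacent threads and that a cylinder is not a union of classes.
  Hence \<open>K n S\<close> is closed but in general not open, a point may occupy an edge rather
  than a vertex of a level, and a thread lying between \<open>x\<close> and \<open>y\<close> may
  belong to the class of \<open>x\<close>, in which case it separates nothing. This is why
  separation carries non-adjacency hypotheses, why open sets are obtained as complements of some
  \<open>K n S\<close>, and why chosen threads sometimes have to be replaced by others over the same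
  vertex.\<close>

lemma gcs_iff:
  "graph_connected_set G W \<longleftrightarrow>
     (\<forall>S. W \<inter> S \<noteq> {} \<longrightarrow> W - S \<noteq> {} \<longrightarrow> (\<exists>p\<in>W \<inter> S. \<exists>q\<in>W - S. (p, q) \<in> snd G))"
  (is "?L = ?R")
proof
  assume L: ?L
  show ?R
  proof (intro allI impI, rule ccontr)
    fix S assume "W \<inter> S \<noteq> {}" "W - S \<noteq> {}" "\<not> (\<exists>p\<in>W \<inter> S. \<exists>q\<in>W - S. (p, q) \<in> snd G)"
    moreover have "W = (W \<inter> S) \<union> (W - S)" "(W \<inter> S) \<inter> (W - S) = {}" by auto
    ultimately show False using L unfolding graph_connected_set_def by blast
  qed
next
  assume R: ?R
  show ?L
    unfolding graph_connected_set_def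
  proof
    assume "\<exists>P Q. W = P \<union> Q \<and> P \<noteq> {} \<and> Q \<noteq> {} \<and> P \<inter> Q = {} \<and> (\<forall>p\<in>P. \<forall>q\<in>Q. (p, q) \<notin> snd G)"
    then obtain P Q where *: "W = P \<union> Q" "P \<noteq> {}" "Q \<noteq> {}" "P \<inter> Q = {}"
      "\<forall>p\<in>P. \<forall>q\<in>Q. (p, q) \<notin> snd G" by blast
    have "W \<inter> P = P" "W - P = Q" using * by auto
    then show False using R * by metis
  qed
qed

lemma gcs_crossing:
  assumes "graph_connected_set G W" "x \<in> W" "x \<in> S" "y \<in> W" "y \<notin> S"
  shows "\<exists>p q. p \<in> W \<and> p \<in> S \<and> q \<in> W \<and> q \<notin> S \<and> (p, q) \<in> snd G"
  using assms unfolding gcs_iff by blast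

lemma gcs_singleton: "graph_connected_set G {a}"
  unfolding gcs_iff by auto

lemma is_graph_symD: "is_graph G \<Longrightarrow> (u, v) \<in> snd G \<Longrightarrow> (v, u) \<in> snd G"
  unfolding is_graph_def by blast

lemma is_graph_in: "is_graph G \<Longrightarrow> (u, v) \<in> snd G \<Longrightarrow> u \<in> fst G \<and> v \<in> fst G"
  unfolding is_graph_def by blast

lemma is_graph_refl: "is_graph G \<Longrightarrow> u \<in> fst G \<Longrightarrow> (u, u) \<in> snd G"
  unfolding is_graph_def by blast

lemma gcs_Un_edge:
  assumes G: "is_graph G" and A: "graph_connected_set G A" and B: "graph_connected_set G B"
    and ab: "a \<in> A" "b \<in> B" "(a, b) \<in> snd G"
  shows "graph_connected_set G (A \<union> B)"
  unfolding gcs_iff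
proof (intro allI impI)
  fix S assume 1: "(A \<union> B) \<inter> S \<noteq> {}" and 2: "A \<union> B - S \<noteq> {}"
  have ba: "(b, a) \<in> snd G" using is_graph_symD[OF G ab(3)] .
  consider "A \<inter> S \<noteq> {}" "A - S \<noteq> {}" | "B \<inter> S \<noteq> {}" "B - S \<noteq> {}"
    | "A \<subseteq> S" "B \<inter> S = {}" | "B \<subseteq> S" "A \<inter> S = {}"
    using 1 2 by blast
  then show "\<exists>p\<in>(A \<union> B) \<inter> S. \<exists>q\<in>A \<union> B - S. (p, q) \<in> snd G"
  proof cases
    case 1 then show ?thesis using A unfolding gcs_iff by blast
  next
    case 2 then show ?thesis using B unfolding gcs_iff by blast
  next
    case 3 then show ?thesis using ab by blast
  next
    case 4 then show ?thesis using ab ba by blast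
  qed
qed

lemma gcs_Un:
  assumes G: "is_graph G" and A: "graph_connected_set G A" and B: "graph_connected_set G B"
    and "a \<in> A" "a \<in> B" "a \<in> fst G"
  shows "graph_connected_set G (A \<union> B)"
  using gcs_Un_edge[OF G A B assms(4,5)] is_graph_refl[OF G assms(6)] by blast

lemma gcs_insert_edge:
  assumes "is_graph G" "graph_connected_set G A" "a \<in> A" "(a, b) \<in> snd G"
  shows "graph_connected_set G (insert b A)"
  using gcs_Un_edge[OF assms(1,2) gcs_singleton assms(3) _ assms(4), of b] by simp

lemma gcs_edge:
  assumes "is_graph G" "(a, b) \<in> snd G"
  shows "graph_connected_set G {a, b}"
  using gcs_insert_edge[OF assms(1) gcs_singleton _ assms(2)] by (simp add: insert_commute)

lemma is_path_take:
  assumes "is_path G a b p" "i < length p"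
  shows "is_path G a (p ! i) (take (Suc i) p)"
  using assms unfolding is_path_def
  by (auto simp: last_conv_nth min_def not_less_eq_eq le_antisym dest: in_set_takeD)
    (metis One_nat_def Suc_pred diff_Suc_1 le_antisym Suc_leI length_greater_0_conv)

lemma is_path_snoc:
  assumes "is_path G a b p" "(b, c) \<in> snd G" "c \<in> fst G" "c \<notin> set p"
  shows "is_path G a c (p @ [c])"
proof -
  have "((p @ [c]) ! i, (p @ [c]) ! Suc i) \<in> snd G" if i: "Suc i < length (p @ [c])" for i
  proof (cases "Suc i < length p")
    case True
    then show ?thesis using assms(1) unfolding is_path_def by (simp add: nth_append)
  next
    case False
    then have "i = length p - 1" "Suc i = length p" using i by auto
    moreover have "p ! (length p - 1) = b" using assms(1) unfolding is_path_def by (metis last_conv_nth)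
    ultimately show ?thesis using assms(2) by (simp add: nth_append)
  qed
  then show ?thesis using assms unfolding is_path_def by auto
qed

lemma is_path_edge:
  assumes "is_graph G" "(a, b) \<in> snd G" "a \<noteq> b"
  shows "is_path G a b [a, b]"
  using assms is_graph_in[OF assms(1,2)] unfolding is_path_def by auto

section \<open>Edge cuts in trees\<close>

definition is_cut :: "'a set \<times> ('a \<times> 'a) set \<Rightarrow> 'a \<Rightarrow> 'a \<Rightarrow> 'a set \<Rightarrow> bool" where
  "is_cut G u v S \<longleftrightarrow> S \<subseteq> fst G \<and> u \<in> S \<and> v \<notin> S
     \<and> (\<forall>p q. (p, q) \<in> snd G \<longrightarrow> p \<in> S \<longrightarrow> q \<notin> S \<longrightarrow> p = u \<and> q = v)"

definition side :: "'a set \<times> ('a \<times> 'a) set \<Rightarrow> 'a \<Rightarrow> 'a \<Rightarrow> 'a set" where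
  "side G u v = {x \<in> fst G. \<exists>p. is_path G u x p \<and> v \<notin> set p}"

lemma is_treeD:
  assumes "is_tree G"
  shows "is_graph G" "finite (fst G)"
  using assms unfolding is_tree_def by auto

lemma is_path_prefix_to:
  assumes "is_path G a b p" "y \<in> set p"
  obtains q where "is_path G a y q" "set q \<subseteq> set p"
proof -
  obtain i where "i < length p" "p ! i = y" using assms(2) by (auto simp: in_set_conv_nth)
  then have "is_path G a y (take (Suc i) p)" using is_path_take[OF assms(1)] by blast
  then show ?thesis using that[of "take (Suc i) p"] set_take_subset[of "Suc i" p] by simp
qed

text \<open>An edge leaving the side extends a path avoiding \<open>v\<close>, so it must end in
  \<open>v\<close>; the extended path is then the unique path from \<open>u\<close> to
  \<open>v\<close>, which is the edge itself, and so the edge starts in \<open>u\<close>.\<close>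

lemma side_is_cut:
  assumes T: "is_tree G" and e: "(u, v) \<in> snd G" "u \<noteq> v"
  shows "is_cut G u v (side G u v)"
proof -
  note G = is_treeD(1)[OF T]
  have uv: "u \<in> fst G" "v \<in> fst G" using is_graph_in[OF G e(1)] by auto
  have "is_path G u u [u]" unfolding is_path_def using uv by auto
  then have u: "u \<in> side G u v" unfolding side_def using uv e by force
  have v: "v \<notin> side G u v" unfolding side_def is_path_def by force
  have "x = u \<and> y = v" if xy: "(x, y) \<in> snd G" "x \<in> side G u v" "y \<notin> side G u v" for x y
  proof -
    obtain p where p: "is_path G u x p" "v \<notin> set p" using xy unfolding side_def by blast
    have y: "y \<in> fst G" using is_graph_in[OF G xy(1)] by blast
    have yp: "y \<notin> set p"
    proof
      assume "y \<in> set p"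
      then obtain q where "is_path G u y q" "set q \<subseteq> set p" using is_path_prefix_to[OF p(1)] by blast
      then show False using xy(3) y p(2) unfolding side_def by blast
    qed
    have py: "is_path G u y (p @ [y])" using is_path_snoc[OF p(1) xy(1) y yp] .
    then have "v \<in> set (p @ [y])" using xy(3) y unfolding side_def by blast
    then have yv: "y = v" using p(2) by auto
    have "\<exists>!q. is_path G u v q" using T uv e unfolding is_tree_def by blast
    then have "p @ [v] = [u, v]" using py is_path_edge[OF G e] yv by blast
    then have "p = [u]" by auto
    then have "x = u" using p(1) unfolding is_path_def by auto
    then show ?thesis using yv by blast
  qed
  then show ?thesis unfolding is_cut_def using u v by (auto simp: side_def)
qed

lemma tree_connected:
  assumes T: "is_tree G"
  shows "graph_connected_set G (fst G)"
  unfolding gcs_iff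
proof (intro allI impI)
  fix S assume "fst G \<inter> S \<noteq> {}" "fst G - S \<noteq> {}"
  then obtain x y where xy: "x \<in> fst G" "x \<in> S" "y \<in> fst G" "y \<notin> S" by blast
  then obtain p where p: "is_path G x y p" using T unfolding is_tree_def by metis
  define i where "i = (LEAST i. i < length p \<and> p ! i \<notin> S)"
  have "length p - 1 < length p \<and> p ! (length p - 1) \<notin> S"
    using p xy unfolding is_path_def by (auto simp: last_conv_nth)
  then have i: "i < length p \<and> p ! i \<notin> S" unfolding i_def by (rule LeastI)
  have i0: "i \<noteq> 0" using p xy i unfolding is_path_def by (metis hd_conv_nth)
  then have "\<not> (i - 1 < length p \<and> p ! (i - 1) \<notin> S)" unfolding i_def by (intro not_less_Least) auto
  then have *: "p ! (i - 1) \<in> S" using i by auto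
  have "(p ! (i - 1), p ! i) \<in> snd G" using p i i0 unfolding is_path_def
    by (metis Suc_pred' neq0_conv)
  moreover have "p ! (i - 1) \<in> fst G" "p ! i \<in> fst G" using p i unfolding is_path_def
    by (meson less_imp_diff_less nth_mem subsetD)+
  ultimately show "\<exists>p\<in>fst G \<inter> S. \<exists>q\<in>fst G - S. (p, q) \<in> snd G" using * i by blast
qed

text \<open>\<open>Z\<close> collects the vertices through which \<open>S\<close> can be left. The
  freedom in \<open>S\<close> and \<open>Z\<close> lets one statement serve a cut, its complement,
  and a cut with its end vertex removed.\<close>

lemma path_stays_in_cut:
  assumes "set p \<subseteq> fst G" "\<forall>i. Suc i < length p \<longrightarrow> (p ! i, p ! Suc i) \<in> snd G"
    and S: "\<forall>x y. (x, y) \<in> snd G \<longrightarrow> x \<in> S \<longrightarrow> y \<notin> S \<longrightarrow> y \<in> Z" and "set p \<inter> Z = {}" "p \<noteq> []" "hd p \<in> S"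
  shows "last p \<in> S"
proof -
  have "i < length p \<longrightarrow> p ! i \<in> S" for i
  proof (induction i)
    case 0 then show ?case using assms by (metis hd_conv_nth)
  next
    case (Suc i)
    show ?case
    proof
      assume i: "Suc i < length p"
      then have "(p ! i, p ! Suc i) \<in> snd G" "p ! i \<in> S" "p ! Suc i \<notin> Z"
        using assms Suc by (auto dest: nth_mem)
      then show "p ! Suc i \<in> S" using S by blast
    qed
  qed
  then show ?thesis using assms(5) by (simp add: last_conv_nth)
qed

text \<open>If the second vertices \<open>u\<close> and \<open>v\<close> differ, the cut
  \<open>S\<close> of the edge from \<open>a\<close> to \<open>u\<close> keeps the rest of one path
  outside \<open>S\<close> and the rest of the other inside, so the two cannot end in the same
  vertex.\<close>

lemma paths_unique:
  assumes G: "is_graph G" and cut: "\<And>u v. (u, v) \<in> snd G \<Longrightarrow> u \<noteq> v \<Longrightarrow> \<exists>S. is_cut G u v S"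
  shows "is_path G a b p \<Longrightarrow> is_path G a b q \<Longrightarrow> p = q"
proof (induction p arbitrary: a q)
  case Nil then show ?case by (simp add: is_path_def)
next
  case (Cons x p)
  have x: "x = a" using Cons.prems unfolding is_path_def by simp
  obtain q' where q: "q = a # q'" using Cons.prems(2) unfolding is_path_def by (cases q) auto
  show ?case
  proof (cases "p = [] \<or> q' = []")
    case True
    then have "b = a" using Cons.prems q x unfolding is_path_def by auto
    then show ?thesis using Cons.prems q x unfolding is_path_def
      by (metis distinct.simps(2) last.simps last_in_set)
  next
    case False
    then obtain u p' v q'' where pq: "p = u # p'" "q' = v # q''" by (metis neq_Nil_conv)
    have sh: "(y, hd r) \<in> snd G \<and> is_path G (hd r) b r \<and> y \<notin> set r"
      if "is_path G a b (y # r)" "r \<noteq> []" for y r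
    proof -
      have "\<forall>i. Suc i < length (y # r) \<longrightarrow> ((y # r) ! i, (y # r) ! Suc i) \<in> snd G"
        using that(1) unfolding is_path_def by blast
      then have "(y, hd r) \<in> snd G" "\<forall>i. Suc i < length r \<longrightarrow> (r ! i, r ! Suc i) \<in> snd G"
        using that(2) by (force simp: hd_conv_nth)+
      then show ?thesis using that unfolding is_path_def by auto
    qed
    have P: "(a, u) \<in> snd G" "is_path G u b p" "a \<notin> set p"
      using sh[of x p] Cons.prems pq x by auto
    have Q: "(a, v) \<in> snd G" "is_path G v b q'" "a \<notin> set q'"
      using sh[of a q'] Cons.prems q pq by auto
    show ?thesis
    proof (cases "u = v")
      case True
      then show ?thesis using Cons.IH[OF P(2)] Q(2) x q by simp
    next
      case False
      have "a \<noteq> u" using P(3) pq by auto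
      then obtain S where S: "is_cut G a u S" using cut P(1) by blast
      have "v \<in> S" using S Q(1) False unfolding is_cut_def by blast
      then have b: "b \<in> S \<or> u \<in> set q'"
        using path_stays_in_cut[of q' G S "{u}"] S Q(2) pq unfolding is_path_def is_cut_def by force
      have "\<forall>x y. (x, y) \<in> snd G \<longrightarrow> x \<in> - S \<longrightarrow> y \<notin> - S \<longrightarrow> y \<in> {a}"
        using S is_graph_symD[OF G] unfolding is_cut_def by blast
      then have bn: "b \<notin> S"
        using path_stays_in_cut[of p G "- S" "{a}"] S P(2,3) pq unfolding is_path_def is_cut_def by force
      \<comment> \<open>\<open>a\<close> is the only exit from \<open>S\<close> and
        \<open>q'\<close> avoids it, so even \<open>S\<close> without \<open>a\<close> is never
        left.\<close>
      have "last q' \<in> S"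
      proof -
        have "\<forall>x y. (x, y) \<in> snd G \<longrightarrow> x \<in> S \<inter> - {a} \<longrightarrow> y \<notin> S \<inter> - {a} \<longrightarrow> y \<in> {a}"
          using S unfolding is_cut_def by blast
        then have "last q' \<in> S \<inter> - {a}"
          by (rule path_stays_in_cut[rotated 2])
            (use Q(2,3) \<open>v \<in> S\<close> pq in \<open>auto simp: is_path_def\<close>)
        then show ?thesis by blast
      qed
      then show ?thesis using bn Q(2) unfolding is_path_def by simp
    qed
  qed
qed

text \<open>Serves for modified trees: a cut pulls back along a collapsing map, whereas paths would
  have to be rewritten. Paths exist because the set of vertices reachable from \<open>a\<close> is
  closed under edges.\<close>

lemma is_treeI:
  assumes G: "is_graph G" and fin: "finite (fst G)" and con: "graph_connected_set G (fst G)"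
    and cut: "\<And>u v. (u, v) \<in> snd G \<Longrightarrow> u \<noteq> v \<Longrightarrow> \<exists>S. is_cut G u v S"
  shows "is_tree G"
proof -
  have "\<exists>p. is_path G a b p" if a: "a \<in> fst G" and b: "b \<in> fst G" for a b
  proof (rule ccontr)
    assume nb: "\<nexists>p. is_path G a b p"
    have "is_path G a a [a]" using a unfolding is_path_def by auto
    then have "a \<in> {z. \<exists>p. is_path G a z p}" "b \<notin> {z. \<exists>p. is_path G a z p}" using nb by auto
    from gcs_crossing[OF con a this(1) b this(2)]
    obtain x y p where p: "is_path G a x p" and y: "\<nexists>p. is_path G a y p" and "y \<in> fst G" "(x, y) \<in> snd G"
      by blast
    show False
      using y is_path_snoc[OF p \<open>(x, y) \<in> snd G\<close> \<open>y \<in> fst G\<close>] is_path_prefix_to[OF p, of y] by blast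
  qed
  then show ?thesis unfolding is_tree_def using G fin paths_unique[OF G cut] by blast
qed

lemma cut_traps_connected:
  assumes G: "is_graph G" and S: "is_cut G u v S" and W: "graph_connected_set G W"
    and x: "x \<in> W" "x \<in> S" and uv: "\<not> (u \<in> W \<and> v \<in> W)"
  shows "W \<subseteq> S"
proof
  fix y assume y: "y \<in> W"
  show "y \<in> S"
  proof (rule ccontr)
    assume "y \<notin> S"
    then obtain p r where "p \<in> W" "p \<in> S" "r \<in> W" "r \<notin> S" "(p, r) \<in> snd G"
      using gcs_crossing[OF W x y] by blast
    then show False using S uv unfolding is_cut_def by blast
  qed
qed

lemma is_cut_compl:
  assumes G: "is_graph G" and S: "is_cut G u v S" "v \<in> fst G"
  shows "is_cut G v u (fst G - S)"
  using S is_graph_symD[OF G] is_graph_in[OF G] unfolding is_cut_def by blast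

text \<open>If \<open>S\<close> fell apart, the part without \<open>u\<close> would have no edge
  leaving it at all, against connectedness of the whole graph.\<close>

lemma cut_connected:
  assumes G: "is_graph G" and con: "graph_connected_set G (fst G)" and S: "is_cut G u v S"
  shows "graph_connected_set G S"
  unfolding gcs_iff
proof (intro allI impI, rule ccontr)
  fix R assume R: "S \<inter> R \<noteq> {}" "S - R \<noteq> {}" "\<not> (\<exists>p\<in>S \<inter> R. \<exists>q\<in>S - R. (p, q) \<in> snd G)"
  define Q where "Q = (if u \<in> R then S - R else S \<inter> R)"
  have Q: "Q \<subseteq> S" "Q \<noteq> {}" "u \<notin> Q" unfolding Q_def using R S by auto
  have closed: "q' \<in> Q" if "(q, q') \<in> snd G" "q \<in> Q" "q' \<in> S" for q q'
    using that R(3) is_graph_symD[OF G] unfolding Q_def by (auto split: if_splits)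
  obtain q where "q \<in> Q" using Q by blast
  moreover have "u \<in> fst G" "S \<subseteq> fst G" using S unfolding is_cut_def by auto
  ultimately have "\<exists>p r. p \<in> fst G \<and> p \<in> Q \<and> r \<in> fst G \<and> r \<notin> Q \<and> (p, r) \<in> snd G"
    using gcs_crossing[OF con, of q Q u] Q by blast
  then obtain p r where "p \<in> Q" "r \<notin> Q" "(p, r) \<in> snd G" by blast
  then have "r \<notin> S" using closed by blast
  then have "p = u" using S \<open>p \<in> Q\<close> \<open>(p, r) \<in> snd G\<close> Q unfolding is_cut_def by blast
  then show False using Q \<open>p \<in> Q\<close> by blast
qed

lemma cut_compl_connected:
  assumes "is_graph G" "graph_connected_set G (fst G)" "is_cut G u v S" "v \<in> fst G"
  shows "graph_connected_set G (fst G - S)"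
  using cut_connected[OF assms(1,2) is_cut_compl[OF assms(1,3,4)]] .

text \<open>The vertices of \<open>W\<close> together with those behind some edge leaving
  \<open>W\<close> are closed under edges: an edge leaving \<open>W\<close> leads behind itself, and
  an edge coming back from behind \<open>(a, b)\<close> can only end in \<open>a\<close>.\<close>

lemma tree_branch:
  assumes T: "is_tree G" and W: "W \<subseteq> fst G" "W \<noteq> {}" and y: "y \<in> fst G" "y \<notin> W"
  obtains a b where "a \<in> W" "b \<notin> W" "(a, b) \<in> snd G" "y \<notin> side G a b"
proof (rule ccontr)
  assume neg: "\<not> thesis"
  note G = is_treeD(1)[OF T]
  define P where "P = W \<union> {z \<in> fst G. \<exists>a b. a \<in> W \<and> b \<notin> W \<and> (a, b) \<in> snd G \<and> z \<notin> side G a b}"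
  have "y \<notin> P" using neg that y unfolding P_def by blast
  moreover obtain w where "w \<in> W" using W by blast
  moreover have "w \<in> fst G" "w \<in> P" using \<open>w \<in> W\<close> W unfolding P_def by auto
  ultimately obtain p q where pq: "p \<in> P" "q \<in> fst G" "q \<notin> P" "(p, q) \<in> snd G"
    using gcs_crossing[OF tree_connected[OF T], of w P y] y by metis
  have qW: "q \<notin> W" using pq unfolding P_def by blast
  have qin: "q \<in> side G a b" if "a \<in> W" "b \<notin> W" "(a, b) \<in> snd G" for a b
    using pq that unfolding P_def by blast
  show False
  proof (cases "p \<in> W")
    case True
    then have "p \<noteq> q" using qW by auto
    then show False using side_is_cut[OF T pq(4)] qin[OF True qW pq(4)] unfolding is_cut_def by blast
  next
    case False
    then obtain a b where ab: "a \<in> W" "b \<notin> W" "(a, b) \<in> snd G" "p \<notin> side G a b"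
      using pq unfolding P_def by blast
    then have "is_cut G a b (side G a b)" using side_is_cut[OF T ab(3)] by blast
    then have "q = a" using ab qin[OF ab(1-3)] pq(4) is_graph_symD[OF G] unfolding is_cut_def by blast
    then show False using qW ab by blast
  qed
qed

text \<open>For vertices \<open>x\<close> and \<open>y\<close> of a tree this is the vertex set of
  the path between them. Connected sets make it compatible with monotone maps without following
  paths.\<close>

definition interval :: "'a set \<times> ('a \<times> 'a) set \<Rightarrow> 'a \<Rightarrow> 'a \<Rightarrow> 'a set" where
  "interval G x y = {m. \<forall>S. S \<subseteq> fst G \<longrightarrow> graph_connected_set G S \<longrightarrow> x \<in> S \<longrightarrow> y \<in> S \<longrightarrow> m \<in> S}"

lemma intervalD:
  "m \<in> interval G x y \<Longrightarrow> S \<subseteq> fst G \<Longrightarrow> graph_connected_set G S \<Longrightarrow> x \<in> S \<Longrightarrow> y \<in> S \<Longrightarrow> m \<in> S"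
  unfolding interval_def by blast

lemma interval_connected:
  assumes T: "is_tree G" and xy: "x \<in> fst G" "y \<in> fst G"
  shows "graph_connected_set G (interval G x y)"
  unfolding gcs_iff
proof (intro allI impI)
  let ?I = "interval G x y"
  fix P assume "?I \<inter> P \<noteq> {}" "?I - P \<noteq> {}"
  then obtain q where q: "q \<in> ?I" "q \<notin> P" by blast
  have sub: "?I \<subseteq> fst G" using intervalD[OF _ subset_refl tree_connected[OF T] xy] by blast
  obtain a b where ab: "a \<in> ?I \<inter> P" "b \<notin> ?I \<inter> P" "(a, b) \<in> snd G" "q \<notin> side G a b"
    using tree_branch[OF T, of "?I \<inter> P" q] sub q \<open>?I \<inter> P \<noteq> {}\<close> by blast
  have cut: "is_cut G a b (side G a b)" using side_is_cut[OF T ab(3)] ab by blast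
  \<comment> \<open>Each connected set in question contains \<open>a\<close> and \<open>q\<close>,
    which lie on different sides of the edge from \<open>a\<close> to \<open>b\<close>, so it
    contains both ends.\<close>
  have "b \<in> ?I"
    unfolding interval_def
  proof (intro CollectI allI impI)
    fix S assume S: "S \<subseteq> fst G" "graph_connected_set G S" "x \<in> S" "y \<in> S"
    then have "a \<in> S" "q \<in> S" using intervalD[OF _ S] ab(1) q by auto
    moreover have "a \<in> side G a b" using cut unfolding is_cut_def by blast
    ultimately obtain p r where "p \<in> S" "p \<in> side G a b" "r \<in> S" "r \<notin> side G a b" "(p, r) \<in> snd G"
      using gcs_crossing[OF S(2) _ _ \<open>q \<in> S\<close> ab(4)] by blast
    then show "b \<in> S" using cut unfolding is_cut_def by blast
  qed
  then show "\<exists>p\<in>?I \<inter> P. \<exists>q\<in>?I - P. (p, q) \<in> snd G" using ab by blast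
qed

text \<open>If \<open>z\<close> is off the interval from \<open>x\<close> to \<open>y\<close>, the
  median is the vertex \<open>a\<close> where the branch towards \<open>z\<close> leaves it:
  \<open>x\<close> and \<open>y\<close> are both on the near side of that edge.\<close>

lemma median_exists:
  assumes T: "is_tree G" and xyz: "x \<in> fst G" "y \<in> fst G" "z \<in> fst G"
  obtains m where "m \<in> interval G x y" "m \<in> interval G x z" "m \<in> interval G y z"
proof (cases "z \<in> interval G x y")
  case True
  then show ?thesis using that[of z] unfolding interval_def by blast
next
  case False
  let ?W = "interval G x y"
  have xyW: "x \<in> ?W" "y \<in> ?W" unfolding interval_def by auto
  have sub: "?W \<subseteq> fst G" using intervalD[OF _ subset_refl tree_connected[OF T] xyz(1,2)] by blast
  obtain a b where ab: "a \<in> ?W" "b \<notin> ?W" "(a, b) \<in> snd G" "z \<notin> side G a b"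
    using tree_branch[OF T sub _ xyz(3) False] xyW by blast
  have cut: "is_cut G a b (side G a b)" using side_is_cut[OF T ab(3)] ab by blast
  have "?W \<subseteq> side G a b"
    using cut_traps_connected[OF is_treeD(1)[OF T] cut interval_connected[OF T xyz(1,2)] ab(1)] cut ab
    unfolding is_cut_def by blast
  then have "x \<in> side G a b" "y \<in> side G a b" using xyW by auto
  then have "a \<in> interval G w z" if "w \<in> {x, y}" for w
    unfolding interval_def
  proof (intro CollectI allI impI)
    fix S assume S: "S \<subseteq> fst G" "graph_connected_set G S" "w \<in> S" "z \<in> S"
    have "w \<in> side G a b" using that \<open>x \<in> side G a b\<close> \<open>y \<in> side G a b\<close> by blast
    then obtain p r where "p \<in> S" "p \<in> side G a b" "r \<in> S" "r \<notin> side G a b" "(p, r) \<in> snd G"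
      using gcs_crossing[OF S(2,3) _ S(4) ab(4)] by blast
    then show "a \<in> S" using cut unfolding is_cut_def by blast
  qed
  then show ?thesis using that ab(1) by blast
qed

section \<open>Monotone epimorphisms\<close>

lemma monotone_epiD:
  assumes "is_monotone_epi G H f"
  shows "f ` fst G = fst H" "(x, y) \<in> snd G \<Longrightarrow> (f x, f y) \<in> snd H"
    "S \<subseteq> fst H \<Longrightarrow> graph_connected_set H S \<Longrightarrow> graph_connected_set G {x \<in> fst G. f x \<in> S}"
  using assms unfolding is_monotone_epi_def is_epi_def by auto

lemma monotone_epi_in: "is_monotone_epi G H f \<Longrightarrow> x \<in> fst G \<Longrightarrow> f x \<in> fst H"
  using monotone_epiD(1) by blast

lemma monotone_epi_id: "is_monotone_epi G G (\<lambda>x. x)"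
proof -
  have "{x \<in> fst G. x \<in> S} = S" if "S \<subseteq> fst G" for S using that by auto
  then show ?thesis unfolding is_monotone_epi_def is_epi_def by simp
qed

lemma monotone_epi_comp:
  assumes f: "is_monotone_epi G H f" and g: "is_monotone_epi H K g"
  shows "is_monotone_epi G K (\<lambda>x. g (f x))"
proof -
  have "{x \<in> fst G. g (f x) \<in> S} = {x \<in> fst G. f x \<in> {y \<in> fst H. g y \<in> S}}" for S
    using monotone_epi_in[OF f] by auto
  then have "graph_connected_set G {x \<in> fst G. g (f x) \<in> S}" if "S \<subseteq> fst K" "graph_connected_set K S" for S
    using monotone_epiD(3)[OF f _ monotone_epiD(3)[OF g that]] by auto
  moreover have "(\<lambda>x. g (f x)) ` fst G = fst K"
    using monotone_epiD(1)[OF f] monotone_epiD(1)[OF g] by (metis image_image)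
  moreover have "\<forall>u v. (u, v) \<in> snd K \<longrightarrow> (\<exists>x y. (x, y) \<in> snd G \<and> g (f x) = u \<and> g (f y) = v)"
    using f g unfolding is_monotone_epi_def is_epi_def by metis
  moreover have "\<forall>x y. (x, y) \<in> snd G \<longrightarrow> (g (f x), g (f y)) \<in> snd K"
    using monotone_epiD(2)[OF f] monotone_epiD(2)[OF g] by blast
  ultimately show ?thesis unfolding is_monotone_epi_def is_epi_def by simp
qed

text \<open>In trees, a second edge over the same edge would close a cycle.\<close>
lemma edge_lift_unique:
  assumes TG: "is_tree G" and f: "is_monotone_epi G H f" and TH: "is_tree H"
    and ab: "a \<noteq> b" and e: "(x, y) \<in> snd G" "f x = a" "f y = b" and e': "(x', y') \<in> snd G" "f x' = a" "f y' = b"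
  shows "x = x' \<and> y = y'"
proof -
  note G = is_treeD(1)[OF TG]
  have in1: "x \<in> fst G" "y \<in> fst G" "x' \<in> fst G" "y' \<in> fst G"
    using is_graph_in[OF G e(1)] is_graph_in[OF G e'(1)] by auto
  have "x \<noteq> y" using ab e by auto
  then have cut: "is_cut G x y (side G x y)" using side_is_cut[OF TG e(1)] by blast
  have con: "graph_connected_set G {z \<in> fst G. f z = c}" if "c \<in> fst H" for c
    using monotone_epiD(3)[OF f, of "{c}"] gcs_singleton[of H c] that by simp
  have H: "a \<in> fst H" "b \<in> fst H" using monotone_epi_in[OF f] in1 e by auto
  have A: "{z \<in> fst G. f z = a} \<subseteq> side G x y"
    by (rule cut_traps_connected[OF G cut con[OF H(1)], of x])
      (use in1 e ab cut in \<open>auto simp: is_cut_def\<close>)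
  have cut': "is_cut G y x (fst G - side G x y)" using is_cut_compl[OF G cut in1(2)] .
  have B: "{z \<in> fst G. f z = b} \<subseteq> fst G - side G x y"
    by (rule cut_traps_connected[OF G cut' con[OF H(2)], of y])
      (use in1 e ab cut' in \<open>auto simp: is_cut_def\<close>)
  show ?thesis using A B in1 e' cut unfolding is_cut_def by blast
qed

text \<open>Connected sets around \<open>f x\<close> and \<open>f y\<close> pull back to connected
  sets around \<open>x\<close> and \<open>y\<close>; it is monotonicity, not just preservation of
  edges, that keeps betweenness.\<close>

lemma interval_image:
  assumes f: "is_monotone_epi G H f" and G: "m \<in> interval G x y"
    and xy: "x \<in> fst G" "y \<in> fst G"
  shows "f m \<in> interval H (f x) (f y)"
  unfolding interval_def
proof (intro CollectI allI impI)
  fix S assume S: "S \<subseteq> fst H" "graph_connected_set H S" "f x \<in> S" "f y \<in> S"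
  then show "f m \<in> S" using intervalD[OF G _ monotone_epiD(3)[OF f S(1,2)]] xy by auto
qed

section \<open>Splitting a vertex\<close>

text \<open>A singleton \<open>N\<close> subdivides an edge, an empty \<open>N\<close> attaches a leaf.\<close>
definition split_vertex :: "'a set \<times> ('a \<times> 'a) set \<Rightarrow> 'a \<Rightarrow> 'a \<Rightarrow> 'a set \<Rightarrow> 'a set \<times> ('a \<times> 'a) set" where
  "split_vertex G a c N = (insert c (fst G),
     {(x, y). (x, y) \<in> snd G \<and> \<not> (x = a \<and> y \<in> N) \<and> \<not> (y = a \<and> x \<in> N)
        \<or> x = c \<and> y \<in> N \<or> y = c \<and> x \<in> N
        \<or> x = a \<and> y = c \<or> x = c \<and> y = a \<or> x = c \<and> y = c})"

definition collapse :: "'a \<Rightarrow> 'a \<Rightarrow> 'a \<Rightarrow> 'a" where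
  "collapse a c x = (if x = c then a else x)"

definition neighbours :: "'a set \<times> ('a \<times> 'a) set \<Rightarrow> 'a \<Rightarrow> 'a set" where
  "neighbours G v = {w \<in> fst G. w \<noteq> v \<and> (v, w) \<in> snd G}"

lemma vertex_order_neighbours: "vertex_order G v = card (neighbours G v)"
  unfolding vertex_order_def neighbours_def ..

lemma finite_neighbours: "is_tree G \<Longrightarrow> finite (neighbours G v)"
  using is_treeD(2)[of G] unfolding neighbours_def by simp

context
  fixes G :: "'a set \<times> ('a \<times> 'a) set" and a c :: 'a and N :: "'a set"
  assumes T: "is_tree G" and a: "a \<in> fst G" and c: "c \<notin> fst G" and N: "N \<subseteq> neighbours G a"
begin

private abbreviation "H \<equiv> split_vertex G a c N"

lemma split_facts:
  "is_graph G" "a \<noteq> c" "a \<notin> N" "c \<notin> N"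
  "\<And>x. x \<in> N \<Longrightarrow> (a, x) \<in> snd G \<and> (x, a) \<in> snd G \<and> x \<in> fst G \<and> x \<noteq> a \<and> x \<noteq> c"
  "\<And>x y. (x, y) \<in> snd G \<Longrightarrow> x \<noteq> c \<and> y \<noteq> c"
proof -
  show G: "is_graph G" using is_treeD(1)[OF T] .
  show "a \<noteq> c" "a \<notin> N" "c \<notin> N" using a c N unfolding neighbours_def by auto
  show "(a, x) \<in> snd G \<and> (x, a) \<in> snd G \<and> x \<in> fst G \<and> x \<noteq> a \<and> x \<noteq> c" if "x \<in> N" for x
    using that N c is_graph_symD[OF G] unfolding neighbours_def by auto
  show "x \<noteq> c \<and> y \<noteq> c" if "(x, y) \<in> snd G" for x y
    using is_graph_in[OF G that] c by auto
qed

lemma split_vertices: "fst H = insert c (fst G)"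
  by (simp add: split_vertex_def)

lemma split_edge_iff: "(x, y) \<in> snd H \<longleftrightarrow>
    (x, y) \<in> snd G \<and> \<not> (x = a \<and> y \<in> N) \<and> \<not> (y = a \<and> x \<in> N)
        \<or> x = c \<and> y \<in> N \<or> y = c \<and> x \<in> N
        \<or> x = a \<and> y = c \<or> x = c \<and> y = a \<or> x = c \<and> y = c"
  by (simp add: split_vertex_def)

lemma split_is_graph: "is_graph H"
  unfolding is_graph_def split_vertices
proof (intro conjI ballI allI impI)
  show "snd H \<subseteq> insert c (fst G) \<times> insert c (fst G)"
    using split_facts a is_graph_in[OF split_facts(1)] by (auto simp: split_vertex_def)
  show "(v, v) \<in> snd H" if "v \<in> insert c (fst G)" for v
    using that split_facts is_graph_refl[OF split_facts(1)] unfolding split_edge_iff by blast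
  show "(v, u) \<in> snd H" if "(u, v) \<in> snd H" for u v
    using that is_graph_symD[OF split_facts(1)] unfolding split_edge_iff by blast
qed

lemma collapse_edge: "(x, y) \<in> snd H \<Longrightarrow> (collapse a c x, collapse a c y) \<in> snd G"
  using split_facts is_graph_refl[OF split_facts(1) a] unfolding split_edge_iff collapse_def by auto

lemma edge_lift:
  assumes "(u, v) \<in> snd G"
  obtains x y where "(x, y) \<in> snd H" "collapse a c x = u" "collapse a c y = v"
proof -
  consider "u = a" "v \<in> N" | "v = a" "u \<in> N" | "\<not> (u = a \<and> v \<in> N)" "\<not> (v = a \<and> u \<in> N)" by blast
  then show ?thesis
  proof cases
    case 1 then show ?thesis using that[of c v] split_facts unfolding split_edge_iff collapse_def by auto
  next
    case 2 then show ?thesis using that[of u c] split_facts unfolding split_edge_iff collapse_def by auto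
  next
    case 3 then show ?thesis using that[of u v] assms split_facts unfolding split_edge_iff collapse_def by auto
  qed
qed

lemma split_monotone_epi: "is_monotone_epi H G (collapse a c)"
  unfolding is_monotone_epi_def is_epi_def
proof (intro conjI allI impI)
  show "collapse a c ` fst H = fst G"
    using a c unfolding split_vertices collapse_def by (auto simp: image_iff)
  show "(collapse a c x, collapse a c y) \<in> snd G" if "(x, y) \<in> snd H" for x y
    using collapse_edge[OF that] .
  show "\<exists>x y. (x, y) \<in> snd H \<and> collapse a c x = u \<and> collapse a c y = v" if "(u, v) \<in> snd G" for u v
    using edge_lift[OF that] by metis
  fix W assume W: "W \<subseteq> fst G" "graph_connected_set G W"
  show "graph_connected_set H {x \<in> fst H. collapse a c x \<in> W}" (is "graph_connected_set H ?W")
    unfolding gcs_iff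
  proof (intro allI impI)
    fix S assume S: "?W \<inter> S \<noteq> {}" "?W - S \<noteq> {}"
    have W': "x \<in> ?W \<longleftrightarrow> x \<in> W \<or> x = c \<and> a \<in> W" for x
      using W c unfolding split_vertices collapse_def by auto
    show "\<exists>p\<in>?W \<inter> S. \<exists>q\<in>?W - S. (p, q) \<in> snd H"
    \<comment> \<open>If \<open>S\<close> parts \<open>a\<close> from \<open>c\<close>, the new edge
      crosses. Otherwise, within \<open>?W\<close>, membership in \<open>S\<close> depends only on
      the collapsed vertex, and a crossing edge of \<open>G\<close> lifts.\<close>
    proof (cases "a \<in> W \<and> (a \<in> S \<longleftrightarrow> c \<notin> S)")
      case True
      have "(a, c) \<in> snd H" "(c, a) \<in> snd H" unfolding split_edge_iff by auto
      moreover have "a \<in> ?W" "c \<in> ?W" using True W' by auto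
      ultimately show ?thesis using True by blast
    next
      case False
      have "W \<inter> S \<noteq> {}" "W - S \<noteq> {}" using S W' False by blast+
      then obtain u v where uv: "u \<in> W" "u \<in> S" "v \<in> W" "v \<notin> S" "(u, v) \<in> snd G"
        using W(2) unfolding gcs_iff by blast
      obtain x y where xy: "(x, y) \<in> snd H" "collapse a c x = u" "collapse a c y = v"
        using edge_lift[OF uv(5)] .
      have "x \<in> ?W \<and> y \<in> ?W" using xy uv is_graph_in[OF split_is_graph xy(1)] by auto
      moreover have "x \<in> S" "y \<notin> S" using xy uv False unfolding collapse_def by (auto split: if_splits)
      ultimately show ?thesis using xy(1) by blast
    qed
  qed
qed

lemma split_connected: "graph_connected_set H (fst H)"
proof -
  have "{x \<in> fst H. collapse a c x \<in> fst G} = fst H"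
    using a unfolding split_vertices collapse_def by auto
  then show ?thesis using monotone_epiD(3)[OF split_monotone_epi subset_refl tree_connected[OF T]] by simp
qed

text \<open>An edge that is not collapsed inherits the cut of its image, being the only edge over
  it; the new edge between \<open>a\<close> and \<open>c\<close> needs a cut of its own.\<close>

lemma split_is_tree: "is_tree H"
proof (rule is_treeI[OF split_is_graph _ split_connected])
  show "finite (fst H)" using is_treeD(2)[OF T] unfolding split_vertices by simp
  note G = split_facts(1)
  let ?k = "collapse a c"
  have lift: "\<exists>S. is_cut H u v S" if uv: "(u, v) \<in> snd H" "?k u \<noteq> ?k v" for u v
  proof
    let ?S = "side G (?k u) (?k v)"
    have cut: "is_cut G (?k u) (?k v) ?S" using side_is_cut[OF T collapse_edge[OF uv(1)] uv(2)] .
    have inj: "p = u \<and> q = v" if "(p, q) \<in> snd H" "?k p = ?k u" "?k q = ?k v" for p q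
      using that uv split_facts(2-6) unfolding split_edge_iff collapse_def by (auto split: if_splits)
    show "is_cut H u v {x \<in> fst H. ?k x \<in> ?S}"
      using cut inj collapse_edge is_graph_in[OF split_is_graph] uv(1) unfolding is_cut_def by blast
  qed
  \<comment> \<open>One shore of the new edge: \<open>c\<close> with all branches that were moved
    from \<open>a\<close> to \<open>c\<close>.\<close>
  define R where "R = insert c (\<Union>b\<in>N. side G b a)"
  have sc: "is_cut G b a (side G b a)" if "b \<in> N" for b
    using side_is_cut[OF T, of b a] split_facts(5)[OF that] by blast
  have aR: "a \<notin> R" using sc split_facts unfolding R_def is_cut_def by blast
  have R: "is_cut H c a R"
    unfolding is_cut_def
  proof (intro conjI allI impI aR)
    show "R \<subseteq> fst H" using sc unfolding R_def split_vertices is_cut_def by blast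
    show "c \<in> R" unfolding R_def by blast
    fix p q assume pq: "(p, q) \<in> snd H" "p \<in> R" "q \<notin> R"
    have NR: "N \<subseteq> R" using sc unfolding R_def is_cut_def by blast
    have qc: "q \<noteq> c" "q \<notin> N" using pq \<open>c \<in> R\<close> NR by auto
    have "p = c"
    proof (rule ccontr)
      assume pc: "p \<noteq> c"
      then obtain b where b: "b \<in> N" "p \<in> side G b a" using pq unfolding R_def by blast
      have "p \<noteq> a" using aR pq by blast
      then have "(p, q) \<in> snd G" "\<not> (q = a \<and> p \<in> N)"
        using pq(1) pc qc unfolding split_edge_iff by auto
      moreover have "q \<notin> side G b a" using b pq unfolding R_def by blast
      ultimately show False using sc[OF b(1)] b unfolding is_cut_def by blast
    qed
    then show "p = c" "q = a" using pq(1) qc split_facts(6) unfolding split_edge_iff by auto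
  qed
  fix u v assume uv: "(u, v) \<in> snd H" "u \<noteq> v"
  consider "?k u \<noteq> ?k v" | "u = c" "v = a" | "u = a" "v = c"
    using uv(2) unfolding collapse_def by metis
  then show "\<exists>S. is_cut H u v S"
  proof cases
    case 1 then show ?thesis using lift[OF uv(1)] by blast
  next
    case 2 then show ?thesis using R by blast
  next
    case 3 then show ?thesis
      using is_cut_compl[OF split_is_graph R] a unfolding split_vertices by blast
  qed
qed

lemma split_neighbours_new: "neighbours H c = insert a N"
  using split_facts a unfolding neighbours_def split_vertices split_edge_iff by auto

lemma split_neighbours_old: "neighbours H a = insert c (neighbours G a - N)"
  using split_facts a N unfolding neighbours_def split_vertices split_edge_iff by auto

lemma split_neighbours_other:
  assumes v: "v \<in> fst G" "v \<noteq> a"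
  shows "neighbours H v = (if v \<in> N then (\<lambda>x. if x = a then c else x) ` neighbours G v else neighbours G v)"
proof -
  have *: "w \<in> neighbours H v \<longleftrightarrow> (if v \<in> N then w \<in> (\<lambda>x. if x = a then c else x) ` neighbours G v
      else w \<in> neighbours G v)" for w
    using split_facts(2-6) v a c unfolding neighbours_def split_vertices split_edge_iff image_iff by auto
  show ?thesis by (rule set_eqI) (simp add: *)
qed

text \<open>The bounds are 2 because after the split each of \<open>a\<close> and \<open>c\<close>
  also has the other as a neighbour. Vertices in \<open>N\<close> only exchange the neighbour
  \<open>a\<close> for \<open>c\<close>.\<close>

lemma split_order:
  assumes ord: "\<forall>v\<in>fst G. vertex_order G v \<le> 3" and "card N \<le> 2" "card (neighbours G a - N) \<le> 2"
    and v: "v \<in> fst H"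
  shows "vertex_order H v \<le> 3"
proof -
  have fN: "finite N" using N finite_neighbours[OF T] finite_subset by blast
  consider "v = c" | "v = a" | "v \<in> fst G" "v \<noteq> a" using v unfolding split_vertices by blast
  then show ?thesis
  proof cases
    case 1
    then show ?thesis using split_facts(3) fN assms(2)
      unfolding vertex_order_neighbours by (simp add: split_neighbours_new)
  next
    case 2
    have "card (insert c (neighbours G a - N)) \<le> Suc (card (neighbours G a - N))"
      by (rule card_insert_le_m1[THEN le_trans]) auto
    then show ?thesis using 2 assms(3) unfolding vertex_order_neighbours by (simp add: split_neighbours_old)
  next
    case 3
    have "card (neighbours H v) \<le> card (neighbours G v)"
      unfolding split_neighbours_other[OF 3]
      by (split if_split) (blast intro: card_image_le finite_neighbours[OF T] order_refl)
    then show ?thesis using ord 3(1) unfolding vertex_order_neighbours by fastforce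
  qed
qed

end

section \<open>Splitting within the family of trees of order at most 3\<close>

lemma TM3_split:
  assumes A: "TM3 A" and a: "a \<in> fst A" and c: "c \<notin> fst A" and N: "N \<subseteq> neighbours A a"
    and card: "card N \<le> 2" "card (neighbours A a - N) \<le> 2"
  shows "TM3 (split_vertex A a c N)"
proof -
  have T: "is_tree A" using A unfolding TM3_def by blast
  have "card (fst A) \<le> card (fst (split_vertex A a c N))"
    unfolding split_vertices[OF T a c N] using is_treeD(2)[OF T] by (intro card_mono) auto
  then show ?thesis
    using A split_is_tree[OF T a c N] split_order[OF T a c N _ card] unfolding TM3_def by auto
qed

lemma TM3D:
  assumes "TM3 A"
  shows "is_tree A" "is_graph A" "finite (fst A)" "2 \<le> card (fst A)"
    "v \<in> fst A \<Longrightarrow> card (neighbours A v) \<le> 3"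
  using assms is_treeD[of A] unfolding TM3_def vertex_order_neighbours by auto

lemma TM3_fresh:
  assumes "TM3 A"
  obtains c :: nat where "c \<notin> fst A"
  using TM3D(3)[OF assms] ex_new_if_finite[OF infinite_UNIV_nat] by blast

lemma TM3_subdivide:
  assumes A: "TM3 A" and ab: "(a, b) \<in> snd A" "a \<noteq> b" and c: "c \<notin> fst A"
  shows "TM3 (split_vertex A a c {b})" "is_monotone_epi (split_vertex A a c {b}) A (collapse a c)"
proof -
  have in_A: "a \<in> fst A" "b \<in> fst A" using is_graph_in[OF TM3D(2)[OF A] ab(1)] by auto
  then have N: "{b} \<subseteq> neighbours A a" using ab unfolding neighbours_def by auto
  then have "card (neighbours A a - {b}) \<le> 2" using TM3D(5)[OF A in_A(1)] by (simp add: card_Diff_singleton)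
  then show "TM3 (split_vertex A a c {b})" using TM3_split[OF A in_A(1) c N] by simp
  show "is_monotone_epi (split_vertex A a c {b}) A (collapse a c)"
    using split_monotone_epi[OF TM3D(1)[OF A] in_A(1) c N] .
qed

lemma TM3_has_neighbour:
  assumes A: "TM3 A" and v: "v \<in> fst A"
  obtains w where "(v, w) \<in> snd A" "v \<noteq> w"
proof -
  have "fst A \<noteq> {v}" using TM3D(4)[OF A] by auto
  then obtain u where u: "u \<in> fst A" "u \<noteq> v" using v by blast
  have "\<exists>p q. p \<in> fst A \<and> p \<in> {v} \<and> q \<in> fst A \<and> q \<notin> {v} \<and> (p, q) \<in> snd A"
    using gcs_crossing[OF tree_connected[OF TM3D(1)[OF A]] v _ u(1), of "{v}"] u(2) by blast
  then show ?thesis using that by blast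
qed

section \<open>Threads\<close>

lemma closed_coordinate: "closed {x :: nat \<Rightarrow> nat. x n \<in> S}"
proof -
  have "closed S" unfolding closed_def by (rule open_discrete)
  then have "closed ((\<lambda>x :: nat \<Rightarrow> nat. x n) -` S)" by (rule closed_vimage) simp
  then show ?thesis unfolding vimage_def .
qed

lemma open_coordinate: "open {x :: nat \<Rightarrow> nat. x n \<in> S}"
proof -
  have "open ((\<lambda>x :: nat \<Rightarrow> nat. x n) -` S)" by (rule open_vimage) (simp_all add: open_discrete)
  then show ?thesis unfolding vimage_def .
qed

lemma Hausdorff_euclidean_nat_fun: "Hausdorff_space (euclidean :: (nat \<Rightarrow> nat) topology)"
proof -
  have "Hausdorff_space (euclidean :: nat topology)"
    unfolding Hausdorff_space_def disjnt_def using separation_t2[where 'a = nat] by simp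
  then have "Hausdorff_space (product_topology (\<lambda>n :: nat. euclidean :: nat topology) UNIV)"
    unfolding Hausdorff_space_product_topology by simp
  then show ?thesis by (simp add: euclidean_product_topology)
qed

lemma compact_decreasing_Inter:
  fixes C :: "nat \<Rightarrow> 'a::topological_space set"
  assumes "compact K" and C: "\<And>n. closed (C n)" "\<And>n. C n \<subseteq> K" "\<And>n. C n \<noteq> {}" "\<And>n. C (Suc n) \<subseteq> C n"
  shows "\<exists>x. \<forall>n. x \<in> C n"
proof -
  have dec: "C n \<subseteq> C m" if "m \<le> n" for m n using lift_Suc_antimono_le[of C m n] C(4) that by blast
  have "K \<inter> \<Inter>(range C) \<noteq> {}"
  proof (rule compact_imp_fip[OF assms(1)])
    show "closed T" if "T \<in> range C" for T using that C(1) by blast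
    fix F' assume F': "finite F'" "F' \<subseteq> range C"
    then obtain I where I: "finite I" "F' = C ` I" using finite_subset_image by metis
    obtain m where "\<forall>i\<in>I. i \<le> m" using I(1) finite_nat_set_iff_bounded_le by blast
    then have "C m \<subseteq> \<Inter>F'" using I dec by blast
    then show "K \<inter> \<Inter>F' \<noteq> {}" using C(2)[of m] C(3)[of m] by blast
  qed
  then show ?thesis by blast
qed

locale fraisse_limit =
  fixes F :: "nat \<Rightarrow> fgraph" and \<alpha> :: "nat \<Rightarrow> nat \<Rightarrow> nat"
  assumes limit: "is_proj_fraisse_limit_TM3 F \<alpha>"
begin

abbreviation "L \<equiv> inv_lim_vertices F \<alpha>"
abbreviation "E \<equiv> inv_lim_edges F \<alpha>"

lemma TM3_F: "TM3 (F n)" and step_epi: "is_monotone_epi (F (Suc n)) (F n) (\<alpha> n)"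
  using limit unfolding is_proj_fraisse_limit_TM3_def by auto

lemmas F_tree = TM3D(1)[OF TM3_F] and F_graph = TM3D(2)[OF TM3_F] and F_finite = TM3D(3)[OF TM3_F]

lemma L_in: "x \<in> L \<Longrightarrow> x n \<in> fst (F n)" and L_step: "x \<in> L \<Longrightarrow> \<alpha> n (x (Suc n)) = x n"
  unfolding inv_lim_vertices_def by auto

text \<open>The composite of the bonding maps from level \<open>n + d\<close> to level
  \<open>n\<close>, highest map first. In \<open>bond\<close> the gap is a truncated difference, so
  only \<open>n \<le> k\<close> is meaningful.\<close>

fun bond_by :: "nat \<Rightarrow> nat \<Rightarrow> nat \<Rightarrow> nat" where
  "bond_by n 0 v = v"
| "bond_by n (Suc d) v = bond_by n d (\<alpha> (n + d) v)"

definition bond :: "nat \<Rightarrow> nat \<Rightarrow> nat \<Rightarrow> nat" where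
  "bond n k = bond_by n (k - n)"

lemma bond_refl [simp]: "bond n n v = v"
  unfolding bond_def by simp

lemma bond_Suc: "n \<le> k \<Longrightarrow> bond n (Suc k) v = bond n k (\<alpha> k v)"
  unfolding bond_def by (simp add: Suc_diff_le)

lemma bond_comp:
  assumes "n \<le> m" "m \<le> k"
  shows "bond n m (bond m k v) = bond n k v"
  using assms(2)
proof (induction k arbitrary: v rule: dec_induct)
  case base then show ?case by simp
next
  case (step k) then show ?case using assms(1) by (simp add: bond_Suc)
qed

lemma bond_L:
  assumes "x \<in> L" "n \<le> k"
  shows "bond n k (x k) = x n"
  using assms(2) by (induction k rule: dec_induct) (simp_all add: bond_Suc L_step[OF assms(1)])

lemma bond_epi:
  assumes "n \<le> k"
  shows "is_monotone_epi (F k) (F n) (bond n k)"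
  using assms
proof (induction k rule: dec_induct)
  case base
  have "bond n n = (\<lambda>v. v)" by auto
  then show ?case using monotone_epi_id by simp
next
  case (step k)
  have "bond n (Suc k) = (\<lambda>v. bond n k (\<alpha> k v))" using step bond_Suc by auto
  then show ?case using monotone_epi_comp[OF step_epi step.IH] by simp
qed

lemma edge_down:
  assumes "x \<in> L" "y \<in> L" "n \<le> k" "(x k, y k) \<in> snd (F k)"
  shows "(x n, y n) \<in> snd (F n)"
  using monotone_epiD(2)[OF bond_epi[OF assms(3)] assms(4)] bond_L assms by simp

lemma eq_down: "x \<in> L \<Longrightarrow> y \<in> L \<Longrightarrow> n \<le> k \<Longrightarrow> x k = y k \<Longrightarrow> x n = y n"
  using bond_L by metis

lemma thread_exists:
  assumes v: "v \<in> fst (F n)"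
  obtains x where "x \<in> L" "x n = v"
proof -
  have "\<exists>y. \<forall>d. (y d \<in> fst (F (n + d)) \<and> (d = 0 \<longrightarrow> y d = v)) \<and> \<alpha> (n + d) (y (Suc d)) = y d"
  proof (rule dependent_nat_choice)
    show "\<exists>x. x \<in> fst (F (n + 0)) \<and> (0 = 0 \<longrightarrow> x = v)" using v by auto
    fix x d assume "x \<in> fst (F (n + d)) \<and> (d = 0 \<longrightarrow> x = v)"
    then have "x \<in> \<alpha> (n + d) ` fst (F (Suc (n + d)))" using monotone_epiD(1)[OF step_epi] by auto
    then show "\<exists>y. (y \<in> fst (F (n + Suc d)) \<and> (Suc d = 0 \<longrightarrow> y = v)) \<and> \<alpha> (n + d) y = x" by auto
  qed
  then obtain y where y: "\<And>d. y d \<in> fst (F (n + d))" "y 0 = v" "\<And>d. \<alpha> (n + d) (y (Suc d)) = y d"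
    by blast
  \<comment> \<open>One formula for all levels: \<open>n + k\<close> is at or above both
    \<open>n\<close> and \<open>k\<close>, so the vertices chosen from level \<open>n\<close>
    upwards also determine those below.\<close>
  define x where "x k = bond k (n + k) (y k)" for k
  have "\<alpha> k (x (Suc k)) = x k" for k
  proof -
    have "\<alpha> k (x (Suc k)) = bond k (Suc k) (bond (Suc k) (n + Suc k) (y (Suc k)))"
      unfolding x_def by (simp add: bond_Suc)
    also have "\<dots> = bond k (Suc (n + k)) (y (Suc k))" by (simp add: bond_comp)
    also have "\<dots> = x k" unfolding x_def by (simp add: bond_Suc y(3))
    finally show ?thesis .
  qed
  moreover have "x k \<in> fst (F k)" for k
    unfolding x_def using monotone_epi_in[OF bond_epi y(1)] by simp
  ultimately have "x \<in> L" unfolding inv_lim_vertices_def by blast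
  moreover have "bond n (n + d) (y d) = v" for d
    by (induction d) (simp_all add: y(2,3) bond_Suc)
  then have "x n = v" unfolding x_def by blast
  ultimately show ?thesis using that by blast
qed

text \<open>The lifting property of the limit, applied to the projection onto \<open>F m\<close>.
  The lifted map factors through some level, which is raised to at least \<open>m\<close>; as every
  vertex lies on a thread, the identity on threads becomes one on vertices.\<close>

lemma extension:
  assumes B: "TM3 B" and g: "is_monotone_epi B (F m) g"
  obtains k h where "m \<le> k" "is_monotone_epi (F k) B h" "\<And>v. v \<in> fst (F k) \<Longrightarrow> g (h v) = bond m k v"
proof -
  have "admissible F \<alpha> (F m) (\<lambda>x. x m)"
    unfolding admissible_def using TM3_F monotone_epi_id by blast
  then obtain h where "admissible F \<alpha> B h" and gh: "\<forall>x\<in>L. x m = g (h x)"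
    using limit B g unfolding is_proj_fraisse_limit_TM3_def by blast
  then obtain k0 h' where h': "is_monotone_epi (F k0) B h'" "\<forall>x\<in>L. h x = h' (x k0)"
    unfolding admissible_def by blast
  let ?k = "max m k0"
  have "is_monotone_epi (F ?k) B (\<lambda>v. h' (bond k0 ?k v))"
    using monotone_epi_comp[OF bond_epi h'(1)] by simp
  moreover have "g (h' (bond k0 ?k v)) = bond m ?k v" if v: "v \<in> fst (F ?k)" for v
  proof -
    obtain x where "x \<in> L" "x ?k = v" using thread_exists[OF v] .
    then show ?thesis using gh h'(2) bond_L[of x k0 ?k] bond_L[of x m ?k] by simp
  qed
  ultimately show ?thesis using that[of ?k] by simp
qed

lemma subdivide:
  assumes ab: "(a, b) \<in> snd (F m)" "a \<noteq> b"
  obtains c k h where "c \<notin> fst (F m)" "m \<le> k" "TM3 (split_vertex (F m) a c {b})"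
    "is_monotone_epi (F k) (split_vertex (F m) a c {b}) h"
    "\<And>v. v \<in> fst (F k) \<Longrightarrow> collapse a c (h v) = bond m k v"
proof -
  obtain c where c: "c \<notin> fst (F m)" using TM3_fresh[OF TM3_F] .
  note B = TM3_subdivide[OF TM3_F ab c]
  show ?thesis using extension[OF B] that[OF c _ B(1)] by metis
qed

section \<open>Compactness of the space of threads\<close>

lemma closed_step: "closed {x :: nat \<Rightarrow> nat. \<alpha> n (x (Suc n)) = x n}"
proof -
  have "- {x. \<alpha> n (x (Suc n)) = x n} = (\<Union>b. {x. x (Suc n) \<in> {b}} \<inter> {x. x n \<in> - {\<alpha> n b}})" by auto
  moreover have "open (\<Union>b. {x :: nat \<Rightarrow> nat. x (Suc n) \<in> {b}} \<inter> {x. x n \<in> - {\<alpha> n b}})"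
    by (intro open_UN ballI open_Int open_coordinate)
  ultimately show ?thesis unfolding closed_def by (simp only:)
qed

lemma closed_L: "closed L"
proof -
  have "L = (\<Inter>n. {x. x n \<in> fst (F n)} \<inter> {x. \<alpha> n (x (Suc n)) = x n})"
    unfolding inv_lim_vertices_def by auto
  moreover have "closed (\<Inter>n. {x. x n \<in> fst (F n)} \<inter> {x. \<alpha> n (x (Suc n)) = x n})"
    by (intro closed_INT ballI closed_Int closed_coordinate closed_step)
  ultimately show ?thesis by (simp only:)
qed

lemma L_subset_PiE: "L \<subseteq> (\<Pi>\<^sub>E n\<in>UNIV. fst (F n))"
  unfolding inv_lim_vertices_def by auto

lemma compact_L: "compact L"
proof -
  have "compactin (product_topology (\<lambda>n. euclidean) UNIV) (\<Pi>\<^sub>E n\<in>UNIV. fst (F n))"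
    unfolding compactin_PiE using F_finite by (simp add: finite_imp_compact)
  then have "compact (\<Pi>\<^sub>E n\<in>UNIV. fst (F n))" by (simp add: euclidean_product_topology)
  then show ?thesis using closed_L L_subset_PiE by (metis compact_Int_closed inf.absorb2)
qed

lemma inv_lim_top_eq: "inv_lim_top F \<alpha> = top_of_set L"
proof -
  have "discrete_topology S = top_of_set S" for S :: "nat set"
    unfolding discrete_topology_unique openin_open using open_discrete by auto
  then have "product_topology (\<lambda>n. discrete_topology (fst (F n))) UNIV = top_of_set (\<Pi>\<^sub>E n\<in>UNIV. fst (F n))"
    by (simp add: euclidean_product_topology flip: subtopology_product_topology)
  then show ?thesis unfolding inv_lim_top_def
    using L_subset_PiE by (simp add: subtopology_subtopology Int_absorb1)
qed

section \<open>The edge relation on threads\<close>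

lemma E_iff: "(x, y) \<in> E \<longleftrightarrow> x \<in> L \<and> y \<in> L \<and> (\<forall>n. (x n, y n) \<in> snd (F n))"
  unfolding inv_lim_edges_def by auto

lemma E_refl: "x \<in> L \<Longrightarrow> (x, x) \<in> E"
  unfolding E_iff using is_graph_refl[OF F_graph] L_in by blast

lemma E_sym: "(x, y) \<in> E \<Longrightarrow> (y, x) \<in> E"
  unfolding E_iff using is_graph_symD[OF F_graph] by blast

lemma neq_at_level:
  assumes "x \<in> L" "y \<in> L" "x \<noteq> y"
  obtains n where "\<And>k. n \<le> k \<Longrightarrow> x k \<noteq> y k"
proof -
  obtain n where "x n \<noteq> y n" using assms by blast
  then show ?thesis using that[of n] eq_down[OF assms(1,2)] by blast
qed

text \<open>After subdividing the edge \<open>{x n, y n}\<close>, the vertex above \<open>y n\<close>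
  adjacent to \<open>x n\<close> is not adjacent to the other neighbours of \<open>y n\<close>.\<close>
lemma E_mate_unique:
  assumes xy: "(x, y) \<in> E" "x \<noteq> y" and yz: "(y, z) \<in> E" "y \<noteq> z"
  shows "x = z"
proof (rule ccontr)
  assume "x \<noteq> z"
  have L: "x \<in> L" "y \<in> L" "z \<in> L" using xy yz unfolding E_iff by auto
  obtain n1 n2 n3 where n: "\<And>k. n1 \<le> k \<Longrightarrow> x k \<noteq> y k" "\<And>k. n2 \<le> k \<Longrightarrow> y k \<noteq> z k"
    "\<And>k. n3 \<le> k \<Longrightarrow> x k \<noteq> z k"
    using neq_at_level L xy(2) yz(2) \<open>x \<noteq> z\<close> by metis
  define n where "n = max n1 (max n2 n3)"
  have d: "x n \<noteq> y n" "y n \<noteq> z n" "x n \<noteq> z n" using n unfolding n_def by auto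
  have e: "(y n, x n) \<in> snd (F n)" using E_sym[OF xy(1)] unfolding E_iff by blast
  obtain c k h where c: "c \<notin> fst (F n)" and k: "n \<le> k"
    and h: "is_monotone_epi (F k) (split_vertex (F n) (y n) c {x n}) h"
    and g: "\<And>v. v \<in> fst (F k) \<Longrightarrow> collapse (y n) c (h v) = bond n k v"
    using subdivide[OF e] d by metis
  have col: "collapse (y n) c (h (w k)) = w n" if "w \<in> L" for w
    using g[OF L_in[OF that]] bond_L[OF that k] by simp
  have hx: "h (x k) = x n" and hz: "h (z k) = z n"
    using col[OF L(1)] col[OF L(3)] d unfolding collapse_def by (auto split: if_splits)
  have hy: "h (y k) = y n \<or> h (y k) = c"
    using col[OF L(2)] unfolding collapse_def by (auto split: if_splits)
  have cn: "c \<noteq> x n" "c \<noteq> y n" "c \<noteq> z n" using c L_in L by metis+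
  have "(h (x k), h (y k)) \<in> snd (split_vertex (F n) (y n) c {x n})"
    "(h (y k), h (z k)) \<in> snd (split_vertex (F n) (y n) c {x n})"
    using monotone_epiD(2)[OF h] xy yz unfolding E_iff by blast+
  then show False using hx hy hz d cn
    using is_graph_in[OF F_graph, of _ c n] is_graph_in[OF F_graph, of c _ n] c
    unfolding split_vertex_def by auto
qed

lemma E_trans: "(x, y) \<in> E \<Longrightarrow> (y, z) \<in> E \<Longrightarrow> (x, z) \<in> E"
  using E_mate_unique E_refl unfolding E_iff by metis

lemma cylinder_closed: "closed {x \<in> L. x n \<in> S}"
  using closed_Int[OF closed_L closed_coordinate[of n S]] by (simp add: Collect_conj_eq)

lemma edge_closed:
  fixes S :: "(nat \<times> nat) set"
  shows "closed {p :: (nat \<Rightarrow> nat) \<times> (nat \<Rightarrow> nat). (fst p n, snd p n) \<in> S}"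
proof -
  have c: "continuous_on UNIV (\<lambda>p :: (nat \<Rightarrow> nat) \<times> (nat \<Rightarrow> nat). fst p n)"
     "continuous_on UNIV (\<lambda>p :: (nat \<Rightarrow> nat) \<times> (nat \<Rightarrow> nat). snd p n)"
    by (rule continuous_on_compose2[OF continuous_on_product_coordinates[of n]], auto intro: continuous_intros)+
  then have op: "open ((\<lambda>p :: (nat \<Rightarrow> nat) \<times> (nat \<Rightarrow> nat). fst p n) -` {a} \<inter> (\<lambda>p. snd p n) -` {b})" for a b
    by (intro open_Int open_vimage) (auto simp: open_discrete)
  have "- {p. (fst p n, snd p n) \<in> S}
    = (\<Union>q\<in>-S. (\<lambda>p :: (nat \<Rightarrow> nat) \<times> (nat \<Rightarrow> nat). fst p n) -` {fst q} \<inter> (\<lambda>p. snd p n) -` {snd q})"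
    by auto
  moreover have "open (\<Union>q\<in>-S. (\<lambda>p :: (nat \<Rightarrow> nat) \<times> (nat \<Rightarrow> nat). fst p n) -` {fst q} \<inter> (\<lambda>p. snd p n) -` {snd q})"
    using op by (intro open_UN ballI) blast
  ultimately show ?thesis unfolding closed_def by (simp only:)
qed

lemma E_closed: "closed E"
proof -
  have "E = (L \<times> L) \<inter> (\<Inter>n. {p. (fst p n, snd p n) \<in> snd (F n)})"
    unfolding inv_lim_edges_def by auto
  moreover have "closed ((L \<times> L) \<inter> (\<Inter>n. {p. (fst p n, snd p n) \<in> snd (F n)}))"
    by (intro closed_INT ballI closed_Int closed_Times closed_L edge_closed)
  ultimately show ?thesis by (simp only:)
qed

text \<open>The saturation is a projection of a compact part of \<open>E\<close>. This makes the
  quotient map closed, from which normality of the quotient follows.\<close>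

lemma E_saturation_closed:
  assumes "closed A" "A \<subseteq> L"
  shows "closed (E `` A)"
proof -
  have "E `` A = snd ` (E \<inter> (A \<times> L))" by (force simp: E_iff)
  moreover have "compact (E \<inter> (A \<times> L))"
    using compact_Int_closed[OF compact_L assms(1)] assms(2)
    by (intro closed_Int_compact E_closed compact_Times compact_L) (simp add: Int_absorb1)
  ultimately have "compact (E `` A)"
    using compact_continuous_image[OF continuous_on_snd[OF continuous_on_id]] by metis
  then show ?thesis
    using compactin_imp_closedin[OF Hausdorff_euclidean_nat_fun] by simp
qed

end

section \<open>The quotient space\<close>

context fraisse_limit
begin

abbreviation "X \<equiv> realization F \<alpha>"

definition cls :: "(nat \<Rightarrow> nat) \<Rightarrow> (nat \<Rightarrow> nat) set" where
  "cls x = E `` {x}"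

text \<open>One representative over \<open>S\<close> suffices, so this is the image of a cylinder.
  Over disjoint vertex sets these images may still share points, namely classes with a thread over
  each.\<close>

definition K :: "nat \<Rightarrow> nat set \<Rightarrow> (nat \<Rightarrow> nat) set set" where
  "K n S = {p \<in> cls ` L. \<exists>x\<in>p. x n \<in> S}"

lemma in_cls_iff: "y \<in> cls x \<longleftrightarrow> (x, y) \<in> E"
  unfolding cls_def by auto

lemma cls_eq_iff: "x \<in> L \<Longrightarrow> y \<in> L \<Longrightarrow> cls x = cls y \<longleftrightarrow> (x, y) \<in> E"
  using E_refl E_sym E_trans unfolding set_eq_iff in_cls_iff by meson

lemma in_cls_self: "x \<in> L \<Longrightarrow> x \<in> cls x"
  unfolding in_cls_iff by (rule E_refl)

lemma in_class:
  assumes "p \<in> cls ` L" "x \<in> p"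
  shows "x \<in> L" "p = cls x"
proof -
  obtain y where y: "y \<in> L" "p = cls y" using assms(1) by blast
  then have yx: "(y, x) \<in> E" using assms(2) in_cls_iff by blast
  then show "x \<in> L" unfolding E_iff by blast
  then show "p = cls x" using y yx cls_eq_iff by blast
qed

lemma class_adjacent:
  assumes "p \<in> cls ` L" "x \<in> p" "y \<in> p"
  shows "(x, y) \<in> E"
  using in_class[OF assms(1,2)] assms(3) in_cls_iff by blast

lemma cls_in_K: "x \<in> L \<Longrightarrow> x n \<in> S \<Longrightarrow> cls x \<in> K n S"
  unfolding K_def using in_cls_self by blast

lemma K_eq_image: "K n S = cls ` {x \<in> L. x n \<in> S}"
proof
  show "K n S \<subseteq> cls ` {x \<in> L. x n \<in> S}"
  proof
    fix p assume "p \<in> K n S"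
    then obtain x where x: "p \<in> cls ` L" "x \<in> p" "x n \<in> S" unfolding K_def by blast
    then show "p \<in> cls ` {x \<in> L. x n \<in> S}" using in_class[OF x(1,2)] by blast
  qed
  show "cls ` {x \<in> L. x n \<in> S} \<subseteq> K n S" using cls_in_K by blast
qed

lemma K_mono: "S \<subseteq> T \<Longrightarrow> K n S \<subseteq> K n T"
  unfolding K_def by blast

section \<open>The quotient topology\<close>

lemma openin_X: "openin X U \<longleftrightarrow> U \<subseteq> cls ` L \<and> openin (top_of_set L) {x \<in> L. cls x \<in> U}"
  unfolding realization_def quotient_top_def topology_inverse'[OF istopology_quotient]
  by (simp add: cls_def[abs_def] inv_lim_top_eq)

lemma topspace_X: "topspace X = cls ` L"
proof
  show "topspace X \<subseteq> cls ` L" using openin_X openin_topspace by blast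
  have "{x \<in> L. cls x \<in> cls ` L} = L" by blast
  then have "openin X (cls ` L)" unfolding openin_X by simp
  then show "cls ` L \<subseteq> topspace X" by (rule openin_subset)
qed

lemma closedin_X: "closedin X C \<longleftrightarrow> C \<subseteq> cls ` L \<and> closed {x \<in> L. cls x \<in> C}"
proof -
  let ?A = "{x \<in> L. cls x \<in> C}"
  have "{x \<in> L. cls x \<in> cls ` L - C} = L - ?A" by auto
  then have "openin (top_of_set L) {x \<in> L. cls x \<in> cls ` L - C} \<longleftrightarrow> closedin (top_of_set L) ?A"
    unfolding closedin_def by simp
  also have "\<dots> \<longleftrightarrow> closed ?A"
    unfolding closedin_closed_eq[OF closed_L] by simp
  finally show ?thesis unfolding closedin_def openin_X topspace_X by simp
qed

lemma quotient_cls: "quotient_map (top_of_set L) X cls"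
  unfolding quotient_map_def topspace_X using openin_X by simp

lemma preimage_K: "{x \<in> L. cls x \<in> K n S} = E `` {x \<in> L. x n \<in> S}"
proof (rule set_eqI)
  fix x
  have "x \<in> E `` {x \<in> L. x n \<in> S} \<longleftrightarrow> (\<exists>y. (x, y) \<in> E \<and> y n \<in> S) \<and> x \<in> L"
  proof
    assume "x \<in> E `` {x \<in> L. x n \<in> S}"
    then obtain y where "(y, x) \<in> E" "y n \<in> S" by blast
    then show "(\<exists>y. (x, y) \<in> E \<and> y n \<in> S) \<and> x \<in> L" using E_sym E_iff by blast
  next
    assume "(\<exists>y. (x, y) \<in> E \<and> y n \<in> S) \<and> x \<in> L"
    then obtain y where "(x, y) \<in> E" "y n \<in> S" by blast
    then show "x \<in> E `` {x \<in> L. x n \<in> S}" using E_sym E_iff by blast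
  qed
  then show "x \<in> {x \<in> L. cls x \<in> K n S} \<longleftrightarrow> x \<in> E `` {x \<in> L. x n \<in> S}"
    unfolding K_def by (auto simp: in_cls_iff)
qed

lemma closedin_K: "closedin X (K n S)"
proof -
  have "closed (E `` {x \<in> L. x n \<in> S})" by (rule E_saturation_closed[OF cylinder_closed]) blast
  then show ?thesis unfolding closedin_X preimage_K by (auto simp: K_def)
qed

lemma openin_compl_K: "openin X (cls ` L - K n S)"
  using closedin_K[of n S] unfolding closedin_def topspace_X by blast

lemma closed_map_cls: "closed_map (top_of_set L) X cls"
  unfolding closed_map_def
proof (intro allI impI)
  fix A assume "closedin (top_of_set L) A"
  then have A: "closed A" "A \<subseteq> L" using closedin_closed_eq[OF closed_L] by auto
  have "{x \<in> L. cls x \<in> cls ` A} = E `` A"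
  proof (intro set_eqI iffI)
    fix x assume "x \<in> {x \<in> L. cls x \<in> cls ` A}"
    then obtain y where "x \<in> L" "y \<in> A" "cls x = cls y" by blast
    then show "x \<in> E `` A" using A(2) cls_eq_iff[of y x] by auto
  next
    fix x assume "x \<in> E `` A"
    then obtain y where y: "y \<in> A" "(y, x) \<in> E" by blast
    then have "x \<in> L" "cls y = cls x" using cls_eq_iff[of y x] unfolding E_iff by auto
    then show "x \<in> {x \<in> L. cls x \<in> cls ` A}" using y(1) by (metis (mono_tags) imageI mem_Collect_eq)
  qed
  then show "closedin X (cls ` A)" unfolding closedin_X using E_saturation_closed[OF A] A(2) by auto
qed

section \<open>Compactness and metrizability\<close>

lemma compact_X: "compact_space X"
proof -
  have "compactin (top_of_set L) L" using compact_L by simp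
  then show ?thesis unfolding compact_space_def topspace_X
    using image_compactin quotient_imp_continuous_map[OF quotient_cls] by blast
qed

lemma normal_Hausdorff_X: "normal_space X \<and> Hausdorff_space X"
proof (rule normal_Hausdorff_space_closed_continuous_map_image[OF _ _ closed_map_cls])
  show H: "Hausdorff_space (top_of_set L)" using Hausdorff_euclidean_nat_fun by (rule Hausdorff_space_subtopology)
  show "normal_space (top_of_set L)"
    using compact_L H by (intro compact_Hausdorff_or_regular_imp_normal_space) (simp_all add: compact_space_subtopology)
  show "continuous_map (top_of_set L) X cls" using quotient_cls by (rule quotient_imp_continuous_map)
  show "cls ` topspace (top_of_set L) = topspace X" by (simp add: topspace_X)
qed

lemma K_disjoint:
  assumes "(v, w) \<notin> snd (F n)"
  shows "K n {v} \<inter> K n {w} = {}"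
proof -
  have "(v, w) \<in> snd (F n)" if "p \<in> K n {v}" "p \<in> K n {w}" for p
    using that class_adjacent unfolding K_def E_iff by blast
  then show ?thesis using assms by blast
qed

lemma metrizable_X: "metrizable_space X"
proof -
  \<comment> \<open>One function for every triple of a level and two vertices, separation being
    demanded only for non-adjacent pairs. The index set is countable, so \<open>g\<close> maps into
    a metrizable product.\<close>
  define Q where "Q i f \<longleftrightarrow> (case i of (n, v, w) \<Rightarrow> continuous_map X euclideanreal f \<and>
     ((v, w) \<notin> snd (F n) \<longrightarrow> f ` K n {v} \<subseteq> {0} \<and> f ` K n {w} \<subseteq> {1}))"
    for i :: "nat \<times> nat \<times> nat" and f :: "(nat \<Rightarrow> nat) set \<Rightarrow> real"
  have "\<exists>f. Q i f" for i
  proof -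
    obtain n v w where i: "i = (n, v, w)" by (cases i)
    show ?thesis
    proof (cases "(v, w) \<in> snd (F n)")
      case True
      then have "Q i (\<lambda>_. 0)" unfolding Q_def i by simp
      then show ?thesis by blast
    next
      case False
      have "disjnt (K n {v}) (K n {w})" using K_disjoint[OF False] unfolding disjnt_def .
      then obtain f where "continuous_map X euclideanreal f" "f ` K n {v} \<subseteq> {0}" "f ` K n {w} \<subseteq> {1}"
        using Urysohn_lemma_alt[of X "K n {v}" "K n {w}" 0 1] normal_Hausdorff_X closedin_K by metis
      then show ?thesis unfolding Q_def i by auto
    qed
  qed
  then obtain f where f: "\<And>i. Q i (f i)" by metis
  define g where "g p = (\<lambda>i. f i p)" for p
  have "continuous_map X euclidean g"
  proof -
    have "continuous_map X (product_topology (\<lambda>i. euclideanreal) UNIV) g"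
      unfolding continuous_map_componentwise_UNIV g_def using f unfolding Q_def by (auto split: prod.splits)
    then show ?thesis by (simp add: euclidean_product_topology)
  qed
  moreover have "inj_on g (topspace X)"
  proof (rule inj_onI)
    fix p q assume p: "p \<in> topspace X" "q \<in> topspace X" and g: "g p = g q"
    obtain x y where xy: "x \<in> L" "p = cls x" "y \<in> L" "q = cls y" using p unfolding topspace_X by blast
    show "p = q"
    proof (rule ccontr)
      assume "p \<noteq> q"
      then have "(x, y) \<notin> E" using cls_eq_iff xy by blast
      then obtain n where n: "(x n, y n) \<notin> snd (F n)" using xy unfolding E_iff by blast
      have "p \<in> K n {x n}" "q \<in> K n {y n}" using xy cls_in_K by auto
      moreover have "f (n, x n, y n) ` K n {x n} \<subseteq> {0}" "f (n, x n, y n) ` K n {y n} \<subseteq> {1}"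
        using f[of "(n, x n, y n)"] n unfolding Q_def by auto
      ultimately have "f (n, x n, y n) p = 0" "f (n, x n, y n) q = 1" by blast+
      then show False using g unfolding g_def by (metis zero_neq_one)
    qed
  qed
  ultimately have "embedding_map X euclidean g"
    by (rule continuous_imp_embedding_map[OF _ compact_X Hausdorff_space_euclidean])
  then have "X homeomorphic_space top_of_set (g ` topspace X)"
    unfolding embedding_map_def using homeomorphic_map_imp_homeomorphic_space by blast
  then show ?thesis
    using homeomorphic_metrizable_space metrizable_space_subtopology metrizable_space_euclidean by blast
qed

text \<open>The trace of a point on level \<open>n\<close>. A class has at most two threads, and
  these are adjacent, so the trace is a single vertex or the two ends of an edge.\<close>

definition lev :: "nat \<Rightarrow> (nat \<Rightarrow> nat) set \<Rightarrow> nat set" where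
  "lev n p = (\<lambda>x. x n) ` p"

lemma lev_subset: "p \<in> cls ` L \<Longrightarrow> lev n p \<subseteq> fst (F n)"
  unfolding lev_def using in_class(1)[of p] by (auto intro: L_in)

lemma lev_adjacent: "p \<in> cls ` L \<Longrightarrow> v \<in> lev n p \<Longrightarrow> w \<in> lev n p \<Longrightarrow> (v, w) \<in> snd (F n)"
  unfolding lev_def using class_adjacent[of p] by (auto simp: E_iff)

lemma lev_connected: "p \<in> cls ` L \<Longrightarrow> graph_connected_set (F n) (lev n p)"
  unfolding gcs_iff using lev_adjacent by blast

lemma in_K_iff: "p \<in> K n S \<longleftrightarrow> p \<in> cls ` L \<and> lev n p \<inter> S \<noteq> {}"
  unfolding K_def lev_def by blast

text \<open>A separation of \<open>K n S\<close> lifts to closed sets \<open>P\<close> and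
  \<open>Q\<close> of threads with no limit edge between them. At each higher level the preimage of
  \<open>S\<close> is connected, so some thread of \<open>P\<close> is adjacent there to one of
  \<open>Q\<close>; compactness makes one pair adjacent at all levels.\<close>

lemma K_connected:
  assumes S: "S \<subseteq> fst (F n)" "graph_connected_set (F n) S"
  shows "connectedin X (K n S)"
  unfolding connectedin_closedin
proof (intro conjI notI)
  show "K n S \<subseteq> topspace X" unfolding K_def topspace_X by blast
  assume "\<exists>E1 E2. closedin X E1 \<and> closedin X E2 \<and> K n S \<subseteq> E1 \<union> E2 \<and>
    E1 \<inter> E2 \<inter> K n S = {} \<and> E1 \<inter> K n S \<noteq> {} \<and> E2 \<inter> K n S \<noteq> {}"
  then obtain E1 E2 where E: "closedin X E1" "closedin X E2" "K n S \<subseteq> E1 \<union> E2"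
    "E1 \<inter> E2 \<inter> K n S = {}" "E1 \<inter> K n S \<noteq> {}" "E2 \<inter> K n S \<noteq> {}" by blast
  define P where "P = {x \<in> L. x n \<in> S} \<inter> {x \<in> L. cls x \<in> E1}"
  define Q where "Q = {x \<in> L. x n \<in> S} \<inter> {x \<in> L. cls x \<in> E2}"
  have cl: "closed P" "closed Q" using E(1,2) cylinder_closed unfolding P_def Q_def closedin_X by auto
  have ne: "P \<noteq> {}" "Q \<noteq> {}" using E(5,6) unfolding P_def Q_def K_eq_image by blast+
  have un: "P \<union> Q = {x \<in> L. x n \<in> S}" using E(3) cls_in_K unfolding P_def Q_def by blast
  have noE: "(x, y) \<notin> E" if "x \<in> P" "y \<in> Q" for x y
  proof
    assume "(x, y) \<in> E"
    then have "cls x = cls y" using that cls_eq_iff unfolding P_def Q_def by blast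
    then show False using that E(4) cls_in_K unfolding P_def Q_def by fastforce
  qed
  define C where "C d = {p. (fst p (n + d), snd p (n + d)) \<in> snd (F (n + d))} \<inter> (P \<times> Q)" for d
  have PL: "P \<subseteq> L" "Q \<subseteq> L" unfolding P_def Q_def by auto
  have "\<exists>p. \<forall>d. p \<in> C d"
  proof (rule compact_decreasing_Inter)
    show "compact (P \<times> Q)"
      using compact_Int_closed[OF compact_L] cl PL by (intro compact_Times) (metis Int_absorb1)+
    show "closed (C d)" for d unfolding C_def by (intro closed_Int edge_closed closed_Times) (simp_all add: cl)
    show "C d \<subseteq> P \<times> Q" for d unfolding C_def by blast
    show "C (Suc d) \<subseteq> C d" for d
    proof
      fix p assume "p \<in> C (Suc d)"
      then have p: "fst p \<in> P" "snd p \<in> Q" "(fst p (n + Suc d), snd p (n + Suc d)) \<in> snd (F (n + Suc d))"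
        unfolding C_def by auto
      then have "(fst p (n + d), snd p (n + d)) \<in> snd (F (n + d))"
        using edge_down[of "fst p" "snd p" "n + d" "n + Suc d"] PL by auto
      then show "p \<in> C d" using p unfolding C_def by (simp add: mem_Times_iff)
    qed
    show "C d \<noteq> {}" for d
    proof -
      let ?m = "n + d"
      let ?W = "{v \<in> fst (F ?m). bond n ?m v \<in> S}"
      have W: "graph_connected_set (F ?m) ?W" using monotone_epiD(3)[OF bond_epi S] by simp
      have mem: "x ?m \<in> ?W" if "x \<in> P \<union> Q" for x
        using that un L_in bond_L[of x n ?m] by auto
      have lift: "\<exists>x\<in>P \<union> Q. x ?m = v" if v: "v \<in> ?W" for v
      proof -
        obtain x where "x \<in> L" "x ?m = v" using thread_exists v by blast
        moreover have "x n \<in> S" using bond_L[of x n ?m] calculation v by simp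
        ultimately show ?thesis using un by blast
      qed
      obtain x0 y0 where x0: "x0 \<in> P" "y0 \<in> Q" using ne by blast
      show ?thesis
      \<comment> \<open>\<open>P\<close> and \<open>Q\<close> may share a vertex at this level; then
        its loop is the required edge.\<close>
      proof (cases "y0 ?m \<in> (\<lambda>x. x ?m) ` P")
        case True
        then obtain x where "x \<in> P" "x ?m = y0 ?m" by force
        then have "(x, y0) \<in> C d" using x0 is_graph_refl[OF F_graph] L_in PL unfolding C_def by auto
        then show ?thesis by blast
      next
        case False
        obtain v w where vw: "v \<in> ?W" "v \<in> (\<lambda>x. x ?m) ` P" "w \<in> ?W" "w \<notin> (\<lambda>x. x ?m) ` P"
          "(v, w) \<in> snd (F ?m)"
          using gcs_crossing[OF W mem[of x0] _ mem[of y0] False] x0 by blast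
        then obtain x y where "x \<in> P" "x ?m = v" "y \<in> Q" "y ?m = w" using lift by blast
        then have "(x, y) \<in> C d" using vw unfolding C_def by auto
        then show ?thesis by blast
      qed
    qed
  qed
  then obtain x y where xy: "\<And>d. (x, y) \<in> C d" by (metis surj_pair)
  then have PQ: "x \<in> P" "y \<in> Q" unfolding C_def by blast+
  have "(x k, y k) \<in> snd (F k)" for k
    using edge_down[of x y k "n + k"] PQ PL xy[of k] unfolding C_def by auto
  then show False using noE PQ PL unfolding E_iff by blast
qed

lemma connected_X: "connected_space X"
proof -
  have "K 0 (fst (F 0)) = topspace X" unfolding K_eq_image topspace_X using L_in by auto
  then show ?thesis
    using K_connected[OF subset_refl tree_connected[OF F_tree]] connectedin_topspace by metis
qed

text \<open>A thread that meets the trace of \<open>p\<close> at every level is adjacent at every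
  level to each thread of \<open>p\<close>, so it belongs to \<open>p\<close>. Compactness turns
  this into a statement about one level.\<close>

lemma K_lev_small:
  assumes p: "p \<in> U" and U: "openin X U"
  obtains n where "K n (lev n p) \<subseteq> U"
proof (rule ccontr)
  assume neg: "\<not> thesis"
  have pX: "p \<in> cls ` L" using p openin_subset[OF U] unfolding topspace_X by blast
  define D where "D n = {x \<in> L. x n \<in> lev n p} \<inter> {x \<in> L. cls x \<in> topspace X - U}" for n
  have "\<exists>x. \<forall>n. x \<in> D n"
  proof (rule compact_decreasing_Inter[OF compact_L])
    have "closedin X (topspace X - U)" using U by blast
    then show "closed (D n)" for n unfolding D_def closedin_X using cylinder_closed by auto
    show "D n \<subseteq> L" for n unfolding D_def by blast
    show "D n \<noteq> {}" for n using neg that[of n] unfolding D_def K_eq_image topspace_X by blast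
    show "D (Suc n) \<subseteq> D n" for n
    proof
      fix x assume "x \<in> D (Suc n)"
      then obtain y where x: "x \<in> L" "cls x \<in> topspace X - U" "y \<in> p" "x (Suc n) = y (Suc n)"
        unfolding D_def lev_def by blast
      then have "x n = y n" using eq_down[of x y n "Suc n"] in_class(1)[OF pX] by simp
      then show "x \<in> D n" using x unfolding D_def lev_def by simp
    qed
  qed
  then obtain x where x: "\<And>n. x \<in> D n" by blast
  obtain y where y: "y \<in> L" "p = cls y" using pX by blast
  have "y n \<in> lev n p" for n using y in_cls_self unfolding lev_def by blast
  then have "(x, y) \<in> E" using x lev_adjacent[OF pX] y(1) unfolding E_iff D_def by blast
  then have "cls x = p" using x y cls_eq_iff unfolding D_def by blast
  then show False using x p unfolding D_def by blast
qed

lemma locally_connected_X: "locally_connected_space X"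
  unfolding locally_connected_space_def neighbourhood_base_of
proof (intro allI impI)
  fix W p assume W: "openin X W \<and> p \<in> W"
  then have pX: "p \<in> cls ` L" using openin_subset topspace_X by blast
  obtain n where n: "K n (lev n p) \<subseteq> W" using K_lev_small W by blast
  \<comment> \<open>The connected set over the trace of \<open>p\<close> need not be open. The
    points whose own trace lies entirely in it form an open set.\<close>
  let ?U = "cls ` L - K n (fst (F n) - lev n p)"
  have "p \<in> ?U" using pX by (auto simp: in_K_iff)
  moreover have "?U \<subseteq> K n (lev n p)"
  proof
    fix q assume q: "q \<in> ?U"
    then obtain y where y: "y \<in> L" "q = cls y" by blast
    then have "y n \<in> lev n q" unfolding lev_def using in_cls_self by blast
    then show "q \<in> K n (lev n p)" using q L_in[OF y(1), of n] by (auto simp: in_K_iff)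
  qed
  ultimately show "\<exists>U V. openin X U \<and> connectedin X V \<and> p \<in> U \<and> U \<subseteq> V \<and> V \<subseteq> W"
    using openin_compl_K K_connected[OF lev_subset[OF pX] lev_connected[OF pX]] n by meson
qed

end

section \<open>Separating points\<close>

lemma connected_punctured_circle: "connected (sphere (0::complex) 1 - {z})"
proof (cases "z \<in> sphere 0 1")
  case True
  have "(sphere (0::complex) 1 - {z}) homeomorphic {x :: complex. 1 \<bullet> x = 0}"
    by (rule homeomorphic_punctured_sphere_hyperplane) (use True in auto)
  then show ?thesis
    using homeomorphic_connectedness convex_connected[OF convex_hyperplane] by blast
next
  case False
  then show ?thesis using connected_sphere[of "0::complex" 1] by simp
qed

context fraisse_limit
begin

lemma cylinder_openin: "openin (top_of_set L) {x \<in> L. x n \<in> S}"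
  using openin_open_Int[OF open_coordinate[of n S], of L] by (simp add: Collect_conj_eq)

lemma openin_compl_point: "p \<in> topspace X \<Longrightarrow> openin X (topspace X - {p})"
  using normal_Hausdorff_X by (simp add: closedin_Hausdorff_singleton openin_diff)

text \<open>The separation is between threads that can be linked with \<open>x\<close> at some level
  by a connected set missing \<open>c\<close> and threads that never can; the interval condition
  puts \<open>y\<close> among the latter. Non-adjacency ensures that the classes of \<open>x\<close>
  and \<open>y\<close> survive when that of \<open>c\<close> is removed.\<close>

lemma thread_in_intervals_separates:
  assumes L: "x \<in> L" "y \<in> L" "c \<in> L" and xc: "(x, c) \<notin> E" and yc: "(y, c) \<notin> E"
    and I: "\<And>k. n \<le> k \<Longrightarrow> c k \<in> interval (F k) (x k) (y k)"
    and S: "connectedin X S" "cls x \<in> S" "cls y \<in> S"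
  shows "cls c \<in> S"
proof (rule ccontr)
  assume cS: "cls c \<notin> S"
  \<comment> \<open>A linking set pulls back along monotone bonding maps, so being linked at one
    level implies being linked at all later ones.\<close>
  define reach where "reach j u \<longleftrightarrow> (\<exists>T. T \<subseteq> fst (F j) \<and> graph_connected_set (F j) T \<and> c j \<notin> T \<and> x j \<in> T \<and> u j \<in> T)"
    for j and u :: "nat \<Rightarrow> nat"
  have fibre: "graph_connected_set (F i) {v \<in> fst (F i). bond j i v \<in> T}"
    if "j \<le> i" "T \<subseteq> fst (F j)" "graph_connected_set (F j) T" for i j T
    using monotone_epiD(3)[OF bond_epi[OF that(1)] that(2,3)] .
  have reach_up: "reach i u" if ji: "j \<le> i" and u: "u \<in> L" "reach j u" for i j u
  proof -
    obtain T where T: "T \<subseteq> fst (F j)" "graph_connected_set (F j) T" "c j \<notin> T" "x j \<in> T" "u j \<in> T"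
      using u(2) unfolding reach_def by blast
    have "c i \<notin> {v \<in> fst (F i). bond j i v \<in> T}" "x i \<in> {v \<in> fst (F i). bond j i v \<in> T}"
      "u i \<in> {v \<in> fst (F i). bond j i v \<in> T}"
      using T bond_L[OF _ ji] L u L_in by auto
    then show ?thesis unfolding reach_def using fibre[OF ji T(1,2)] by (metis (no_types, lifting) mem_Collect_eq subsetI)
  qed
  have reach_join: "reach j u'" if u: "reach j u" and T: "T \<subseteq> fst (F j)" "graph_connected_set (F j) T"
    "c j \<notin> T" "u j \<in> T" "u' j \<in> T" for j u u' T
  proof -
    obtain R where R: "R \<subseteq> fst (F j)" "graph_connected_set (F j) R" "c j \<notin> R" "x j \<in> R" "u j \<in> R"
      using u unfolding reach_def by blast
    have "graph_connected_set (F j) (R \<union> T)"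
      using gcs_Un[OF F_graph R(2) T(2) R(5) T(4)] R by blast
    then show ?thesis unfolding reach_def using R T by (intro exI[of _ "R \<union> T"]) auto
  qed
  define U where "U = {u \<in> L. \<exists>j\<ge>n. reach j u}"
  define V where "V = {u \<in> L. u \<noteq> c \<and> \<not> (\<exists>j\<ge>n. reach j u)}"
  have cU: "c \<notin> U" unfolding U_def reach_def by blast
  \<comment> \<open>\<open>U\<close> is closed under \<open>E\<close> except for an edge leading to
    \<open>c\<close> itself. So \<open>U\<close> and \<open>V\<close> become saturated once the
    class of \<open>c\<close> is deleted.\<close>
  have U_edge: "u' \<in> U" if u: "u \<in> U" and e: "(u, u') \<in> E" and c: "u' \<noteq> c" for u u'
  proof -
    obtain j where j: "n \<le> j" "reach j u" and uL: "u \<in> L" "u' \<in> L" using u e unfolding U_def E_iff by blast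
    obtain m0 where m0: "\<And>k. m0 \<le> k \<Longrightarrow> u' k \<noteq> c k" using neq_at_level[OF uL(2) L(3) c] by blast
    define m where "m = max j m0"
    have r: "reach m u" using reach_up[OF _ uL(1) j(2)] unfolding m_def by simp
    then have "c m \<noteq> u m" unfolding reach_def by metis
    moreover have "c m \<noteq> u' m" using m0[of m] unfolding m_def by auto
    moreover have "graph_connected_set (F m) {u m, u' m}"
      using gcs_edge[OF F_graph] e unfolding E_iff by blast
    ultimately have "reach m u'" using reach_join[OF r, of "{u m, u' m}" u'] L_in uL by auto
    moreover have "n \<le> m" using j(1) unfolding m_def by simp
    ultimately show ?thesis using uL(2) unfolding U_def by blast
  qed
  have sat_U: "{u \<in> L. cls u \<in> cls ` U - {cls c}} = U \<inter> {u \<in> L. cls u \<in> topspace X - {cls c}}" (is "?l = ?r")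
  proof (intro set_eqI iffI)
    fix u assume u: "u \<in> ?l"
    then obtain u0 where u0: "u0 \<in> U" "cls u = cls u0" "u \<in> L" "cls u \<noteq> cls c" by blast
    then have "(u0, u) \<in> E" "u \<noteq> c" using cls_eq_iff[of u0 u] unfolding U_def by auto
    then show "u \<in> ?r" using U_edge u0 unfolding topspace_X by blast
  qed (auto simp: U_def)
  have sat_V: "{u \<in> L. cls u \<in> cls ` V - {cls c}} = V \<inter> {u \<in> L. cls u \<in> topspace X - {cls c}}" (is "?l = ?r")
  proof (intro set_eqI iffI)
    fix u assume u: "u \<in> ?l"
    then obtain u0 where u0: "u0 \<in> V" "cls u = cls u0" "u \<in> L" "cls u \<noteq> cls c" by blast
    then have e: "(u, u0) \<in> E" "u \<noteq> c" "u0 \<noteq> c" using cls_eq_iff[of u u0] unfolding V_def by auto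
    have "u \<notin> U" using U_edge[OF _ e(1,3)] u0(1) unfolding U_def V_def by blast
    then show "u \<in> ?r" using u0 e unfolding topspace_X U_def V_def by blast
  qed (auto simp: V_def)
  have open_U: "openin (top_of_set L) U"
  proof (subst openin_subopen, intro ballI)
    fix u assume "u \<in> U"
    then obtain j T where u: "u \<in> L" "n \<le> j" "T \<subseteq> fst (F j)" "graph_connected_set (F j) T" "c j \<notin> T" "x j \<in> T" "u j \<in> T"
      unfolding U_def reach_def by blast
    then have "{u' \<in> L. u' j \<in> T} \<subseteq> U" unfolding U_def reach_def by blast
    then show "\<exists>T. openin (top_of_set L) T \<and> u \<in> T \<and> T \<subseteq> U"
      using cylinder_openin[of j T] u by blast
  qed
  have open_V: "openin (top_of_set L) V"
  proof (subst openin_subopen, intro ballI)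
    fix u assume u: "u \<in> V"
    then have uL: "u \<in> L" "u \<noteq> c" unfolding V_def by auto
    obtain j0 where j0: "\<And>k. j0 \<le> k \<Longrightarrow> u k \<noteq> c k" using neq_at_level[OF uL(1) L(3) uL(2)] by blast
    define j where "j = max j0 n"
    have uj: "u j \<noteq> c j" using j0 unfolding j_def by simp
    have "u' \<in> V" if u': "u' \<in> L" "u' j = u j" for u'
    proof -
      have False if i: "n \<le> i" "reach i u'" for i
      proof -
        define m where "m = max i j"
        have jm: "j \<le> m" unfolding m_def by simp
        \<comment> \<open>The fibre over the vertex \<open>u j\<close> joins \<open>u'\<close> to
          \<open>u\<close> at level \<open>m\<close> and misses \<open>c\<close>, so linking
          \<open>u'\<close> would link \<open>u\<close>.\<close>
        let ?T = "{v \<in> fst (F m). bond j m v \<in> {u j}}"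
        have "reach m u'" using reach_up[OF _ u'(1) i(2)] unfolding m_def by simp
        moreover have "graph_connected_set (F m) ?T"
          using fibre[OF jm _ gcs_singleton] L_in uL by blast
        moreover have "u' m \<in> ?T" "u m \<in> ?T" "c m \<notin> ?T"
          using bond_L[OF _ jm] u' uL L uj L_in by auto
        ultimately have "reach m u" using reach_join[of m u' ?T u] by blast
        then show False using u i(1) unfolding V_def m_def by auto
      qed
      then show ?thesis using u' uj unfolding V_def by auto
    qed
    then have "{u' \<in> L. u' j \<in> {u j}} \<subseteq> V" by blast
    then show "\<exists>T. openin (top_of_set L) T \<and> u \<in> T \<and> T \<subseteq> V"
      using cylinder_openin[of j "{u j}"] uL by blast
  qed
  have cX: "cls c \<in> topspace X" using L unfolding topspace_X by blast
  have "openin (top_of_set L) {u \<in> L. cls u \<in> topspace X - {cls c}}"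
    using openin_compl_point[OF cX] unfolding openin_X by blast
  then have op: "openin X (cls ` U - {cls c})" "openin X (cls ` V - {cls c})"
    unfolding openin_X sat_U sat_V using open_U open_V by (auto simp: U_def V_def)
  have cover: "S \<subseteq> (cls ` U - {cls c}) \<union> (cls ` V - {cls c})"
  proof
    fix p assume p: "p \<in> S"
    then obtain u where u: "u \<in> L" "p = cls u" using connectedin_subset_topspace[OF S(1)] topspace_X by blast
    have "cls u \<noteq> cls c" using p u cS by metis
    moreover have "u \<in> U \<or> u \<in> V" using u calculation unfolding U_def V_def by blast
    ultimately show "p \<in> (cls ` U - {cls c}) \<union> (cls ` V - {cls c})" using u by blast
  qed
  have disj: "(cls ` U - {cls c}) \<inter> (cls ` V - {cls c}) = {}"
  proof -
    have False if "u \<in> U" "v \<in> V" "cls u = cls v" for u v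
    proof -
      have "(u, v) \<in> E" using that cls_eq_iff unfolding U_def V_def by blast
      then have "v \<in> U" using U_edge that unfolding V_def by blast
      then show False using that unfolding U_def V_def by blast
    qed
    then show ?thesis by blast
  qed
  have "x \<noteq> c" "y \<noteq> c" using xc yc E_refl L by auto
  obtain j0 where j0: "\<And>k. j0 \<le> k \<Longrightarrow> x k \<noteq> c k" using neq_at_level[OF L(1,3) \<open>x \<noteq> c\<close>] by blast
  have "reach (max n j0) x"
    unfolding reach_def using gcs_singleton[of "F (max n j0)"] j0[of "max n j0"] L_in[OF L(1)]
    by (intro exI[of _ "{x (max n j0)}"]) auto
  moreover have "n \<le> max n j0" by simp
  ultimately have "x \<in> U" using L(1) unfolding U_def by blast
  moreover have "y \<in> V"
    using L \<open>y \<noteq> c\<close> intervalD[OF I] unfolding V_def reach_def by blast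
  moreover have "cls x \<noteq> cls c" "cls y \<noteq> cls c" using cls_eq_iff L xc yc by auto
  ultimately have "(cls ` U - {cls c}) \<inter> S \<noteq> {}" "(cls ` V - {cls c}) \<inter> S \<noteq> {}" using S by blast+
  then show False using connectedinD[OF S(1) op cover] disj by blast
qed

text \<open>Connectedness of the quotient forces the closed images of the two sides of the edge to
  meet. A common class has threads on both sides, and the only edge between the sides is that from
  \<open>a\<close> to \<open>b\<close>.\<close>

lemma edge_thread_exists:
  assumes ab: "(a, b) \<in> snd (F n)" "a \<noteq> b"
  obtains s t where "(s, t) \<in> E" "s n = a" "t n = b"
proof -
  let ?A = "side (F n) a b"
  let ?B = "fst (F n) - ?A"
  have cut: "is_cut (F n) a b ?A" using side_is_cut[OF F_tree ab] .
  have in_F: "a \<in> fst (F n)" "b \<in> fst (F n)" using is_graph_in[OF F_graph ab(1)] by auto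
  have aA: "a \<in> ?A" and bB: "b \<in> ?B" using cut in_F unfolding is_cut_def by auto
  obtain x y where xy: "x \<in> L" "x n = a" "y \<in> L" "y n = b"
    using thread_exists[OF in_F(1)] thread_exists[OF in_F(2)] by metis
  have ne: "K n ?A \<noteq> {}" "K n ?B \<noteq> {}"
    using cls_in_K[OF xy(1), of n ?A] cls_in_K[OF xy(3), of n ?B] aA bB xy by auto
  have "topspace X \<subseteq> K n ?A \<union> K n ?B"
  proof
    fix p assume "p \<in> topspace X"
    then obtain x where x: "x \<in> L" "p = cls x" unfolding topspace_X by blast
    have "x n \<in> ?A \<or> x n \<in> ?B" using L_in[OF x(1)] by blast
    then show "p \<in> K n ?A \<union> K n ?B" using cls_in_K[OF x(1)] x(2) by blast
  qed
  then have "K n ?A \<inter> K n ?B \<noteq> {}"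
    using connected_X ne closedin_K unfolding connected_space_closedin by blast
  then obtain p s t where p: "p \<in> cls ` L" "s \<in> p" "s n \<in> ?A" "t \<in> p" "t n \<in> ?B"
    unfolding K_def by blast
  then have e: "(s, t) \<in> E" using class_adjacent by blast
  then have "(s n, t n) \<in> snd (F n)" unfolding E_iff by blast
  then have "s n = a" "t n = b" using cut p unfolding is_cut_def by auto
  then show ?thesis using that e by blast
qed

text \<open>The neighbourhoods \<open>K n (lev n p)\<close> shrink to \<open>p\<close>, and a
  coincidence of vertices at a higher level would descend to level \<open>n\<close>.\<close>

lemma level_avoid:
  assumes u: "u \<in> L" and p: "p \<in> cls ` L" and ne: "cls u \<noteq> p"
  obtains n where "\<And>k. n \<le> k \<Longrightarrow> lev k (cls u) \<inter> lev k p = {}"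
proof -
  have uX: "cls u \<in> topspace X" using u unfolding topspace_X by blast
  obtain n where n: "K n (lev n p) \<subseteq> topspace X - {cls u}"
    using K_lev_small[OF _ openin_compl_point[OF uX], of p] p ne unfolding topspace_X by blast
  then have n: "lev n (cls u) \<inter> lev n p = {}" using u in_K_iff[of "cls u" n "lev n p"] by blast
  have "lev k (cls u) \<inter> lev k p = {}" if k: "n \<le> k" for k
  proof (rule ccontr)
    assume "lev k (cls u) \<inter> lev k p \<noteq> {}"
    then obtain w z where wz: "w \<in> cls u" "z \<in> p" "w k = z k" unfolding lev_def by blast
    have "w \<in> L" "z \<in> L" using wz(2) in_class(1)[OF p] in_class(1)[OF _ wz(1)] u by auto
    then have "w n = z n" using eq_down[of w z n k] k wz(3) by blast
    moreover have "w n \<in> lev n (cls u)" "z n \<in> lev n p" using wz unfolding lev_def by auto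
    ultimately show False using n by auto
  qed
  then show ?thesis using that by blast
qed

text \<open>At a level where the traces of the two classes are disjoint, take an edge from
  \<open>a\<close> to \<open>b\<close> leaving the trace of \<open>x\<close> towards
  \<open>y\<close>, and a limit edge over it. Its end \<open>s\<close> over \<open>a\<close> is not
  in the class of \<open>y\<close>, whose trace omits \<open>a\<close>, nor in that of
  \<open>x\<close>, for then its mate over \<open>b\<close> would be there too.\<close>

lemma separating_thread:
  assumes L: "x \<in> L" "y \<in> L" and xy: "(x, y) \<notin> E"
  obtains c n where "c \<in> L" "(x, c) \<notin> E" "(y, c) \<notin> E" "\<And>k. n \<le> k \<Longrightarrow> c k \<in> interval (F k) (x k) (y k)"
proof -
  have pX: "cls x \<in> cls ` L" "cls y \<in> cls ` L" using L by auto
  have "cls y \<noteq> cls x" using xy cls_eq_iff L by metis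
  then obtain n where "\<And>k. n \<le> k \<Longrightarrow> lev k (cls y) \<inter> lev k (cls x) = {}"
    using level_avoid[OF L(2) pX(1)] by metis
  then have n: "lev n (cls y) \<inter> lev n (cls x) = {}" by blast
  let ?W = "lev n (cls x)"
  have xyW: "x n \<in> ?W" "y n \<in> lev n (cls y)" unfolding lev_def using in_cls_self L by auto
  then have yW: "y n \<notin> ?W" using n by blast
  obtain a b where ab: "a \<in> ?W" "b \<notin> ?W" "(a, b) \<in> snd (F n)" "y n \<notin> side (F n) a b"
    using tree_branch[OF F_tree lev_subset[OF pX(1)] _ L_in[OF L(2)] yW] xyW by blast
  have ne: "a \<noteq> b" using ab by blast
  have cut: "is_cut (F n) a b (side (F n) a b)" using side_is_cut[OF F_tree ab(3) ne] .
  have "?W \<subseteq> side (F n) a b"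
    by (rule cut_traps_connected[OF F_graph cut lev_connected[OF pX(1)] ab(1)]) (use cut ab in \<open>auto simp: is_cut_def\<close>)
  then have xs: "x n \<in> side (F n) a b" using xyW by blast
  obtain s t where st: "(s, t) \<in> E" "s n = a" "t n = b" using edge_thread_exists[OF ab(3) ne] .
  have stL: "s \<in> L" "t \<in> L" using st unfolding E_iff by auto
  have "(x, s) \<notin> E"
  proof
    assume "(x, s) \<in> E"
    then have "t \<in> cls x" using E_trans st(1) in_cls_iff by blast
    then show False using ab(2) st(3) unfolding lev_def by blast
  qed
  moreover have "(y, s) \<notin> E"
  proof
    assume "(y, s) \<in> E"
    then have "s n \<in> lev n (cls y)" unfolding lev_def using in_cls_iff by blast
    then show False using n ab(1) st(2) by blast
  qed
  moreover have "s k \<in> interval (F k) (x k) (y k)" if k: "n \<le> k" for k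
    unfolding interval_def
  proof (intro CollectI allI impI)
    fix S assume S: "S \<subseteq> fst (F k)" "graph_connected_set (F k) S" "x k \<in> S" "y k \<in> S"
    \<comment> \<open>A connected set from \<open>x k\<close> to \<open>y k\<close> uses an edge
      over the one from \<open>a\<close> to \<open>b\<close>, and there is just one such edge, that
      of \<open>s k\<close> and \<open>t k\<close>.\<close>
    let ?R = "{v. bond n k v \<in> side (F n) a b}"
    have "x k \<in> ?R" "y k \<notin> ?R" using bond_L[OF _ k] L xs ab(4) by auto
    then obtain u v where uv: "u \<in> S" "u \<in> ?R" "v \<in> S" "v \<notin> ?R" "(u, v) \<in> snd (F k)"
      using gcs_crossing[OF S(2,3) _ S(4)] by blast
    then have "(bond n k u, bond n k v) \<in> snd (F n)" using monotone_epiD(2)[OF bond_epi[OF k]] by blast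
    then have uv': "bond n k u = a" "bond n k v = b" using cut uv unfolding is_cut_def by auto
    have "(s k, t k) \<in> snd (F k)" "bond n k (s k) = a" "bond n k (t k) = b"
      using st bond_L[OF _ k] stL unfolding E_iff by auto
    then have "u = s k" using edge_lift_unique[OF F_tree bond_epi[OF k] F_tree ne uv(5) uv'] by blast
    then show "s k \<in> S" using uv by blast
  qed
  ultimately show ?thesis using that stL by blast
qed

lemma no_circle:
  assumes S: "S \<subseteq> topspace X"
  shows "\<not> subtopology X S homeomorphic_space top_of_set (sphere (0::complex) 1)"
proof
  assume "subtopology X S homeomorphic_space top_of_set (sphere (0::complex) 1)"
  then obtain g where g: "homeomorphic_map (top_of_set (sphere (0::complex) 1)) (subtopology X S) g"
    using homeomorphic_space homeomorphic_space_sym by blast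
  have img: "g ` sphere 0 1 = S" and inj: "inj_on g (sphere 0 1)"
    using homeomorphic_imp_surjective_map[OF g] homeomorphic_imp_injective_map[OF g] S
    by (auto simp: topspace_subtopology_subset)
  have cont: "continuous_map (top_of_set (sphere 0 1)) X g"
    using homeomorphic_imp_continuous_map[OF g] by (simp add: continuous_map_in_subtopology)
  have pm: "(1::complex) \<in> sphere 0 1" "(-1::complex) \<in> sphere 0 1" by auto
  then have gne: "g 1 \<noteq> g (-1)" using inj unfolding inj_on_def by fastforce
  have "g 1 \<in> cls ` L" "g (-1) \<in> cls ` L" using pm img S topspace_X by blast+
  then obtain x y where x: "x \<in> L" "g 1 = cls x" and y: "y \<in> L" "g (-1) = cls y" by auto
  have "(x, y) \<notin> E" using cls_eq_iff[OF x(1) y(1)] gne x y by simp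
  then obtain c n where c: "c \<in> L" "(x, c) \<notin> E" "(y, c) \<notin> E"
    "\<And>k. n \<le> k \<Longrightarrow> c k \<in> interval (F k) (x k) (y k)" using separating_thread[OF x(1) y(1)] by metis
  have cn: "cls c \<noteq> g 1" "cls c \<noteq> g (-1)" using cls_eq_iff x y c by metis+
  \<comment> \<open>\<open>z\<close> is the parameter of the separating point. If that point is not
    on the circle, \<open>0\<close> serves: it is off the unit circle, so removing it changes
    nothing.\<close>
  obtain z where z: "\<And>w. w \<in> sphere 0 1 \<Longrightarrow> w \<noteq> z \<Longrightarrow> g w \<noteq> cls c" "z \<noteq> 1" "z \<noteq> -1"
  proof (cases "\<exists>z\<in>sphere 0 1. g z = cls c")
    case True
    then obtain z where "z \<in> sphere 0 1" "g z = cls c" by blast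
    then show ?thesis using that[of z] inj cn unfolding inj_on_def by metis
  next
    case False
    then show ?thesis using that[of 0] by auto
  qed
  let ?S = "sphere 0 1 - {z}"
  have "connectedin X (g ` ?S)"
    using connectedin_continuous_map_image[OF cont] connected_punctured_circle[of z]
    by (simp add: connectedin_subtopology)
  moreover have "cls x \<in> g ` ?S" "cls y \<in> g ` ?S"
    using pm z x y by (metis Diff_iff imageI singletonD)+
  ultimately have "cls c \<in> g ` ?S"
    using thread_in_intervals_separates[OF x(1) y(1) c(1-3)] c(4) by blast
  then show False using z(1) by fastforce
qed

lemma dendrite_X: "dendrite X"
proof -
  have "fst (F 0) \<noteq> {}" using TM3D(4)[OF TM3_F[of 0]] by auto
  then obtain v where "v \<in> fst (F 0)" by blast
  then have "L \<noteq> {}" using thread_exists by blast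
  then show ?thesis unfolding dendrite_def topspace_X
    using compact_X connected_X metrizable_X locally_connected_X no_circle topspace_X by auto
qed

end

section \<open>Ramification\<close>

definition out_edges :: "fgraph \<Rightarrow> nat set \<Rightarrow> (nat \<times> nat) set" where
  "out_edges B W = {(a, b). a \<in> W \<and> b \<notin> W \<and> (a, b) \<in> snd B}"

lemma out_edges_singleton:
  assumes B: "TM3 B" and a: "a \<in> fst B"
  shows "finite (out_edges B {a})" "card (out_edges B {a}) \<le> 3"
proof -
  have sub: "out_edges B {a} \<subseteq> Pair a ` neighbours B a"
    unfolding out_edges_def neighbours_def using is_graph_in[OF TM3D(2)[OF B]] by auto
  have fin: "finite (neighbours B a)" using finite_neighbours[OF TM3D(1)[OF B]] .
  show "finite (out_edges B {a})" using sub fin finite_subset by blast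
  have "card (out_edges B {a}) \<le> card (neighbours B a)"
    using card_mono[OF _ sub] card_image_le[OF fin, of "Pair a"] fin by force
  then show "card (out_edges B {a}) \<le> 3" using TM3D(5)[OF B a] by linarith
qed

context fraisse_limit
begin

text \<open>For a two-element class \<open>p\<close> the edge \<open>lev m p\<close> may have four outgoing edges; after subdividing
  it, \<open>p\<close> lies over an edge with an end of order 2.\<close>
lemma class_few_out_edges:
  assumes p: "p \<in> cls ` L"
  obtains k B h where "n \<le> k" "TM3 B" "is_monotone_epi (F k) B h"
    "finite (out_edges B (h ` lev k p))" "card (out_edges B (h ` lev k p)) \<le> 3"
    "\<And>v. v \<in> fst (F k) \<Longrightarrow> bond n k v \<notin> lev n p \<Longrightarrow> h v \<notin> h ` lev k p"
proof -
  obtain x where x: "x \<in> L" "p = cls x" using p by blast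
  show ?thesis
  proof (cases "\<exists>y. (x, y) \<in> E \<and> x \<noteq> y")
    case False
    then have "p = {x}" using x in_cls_iff E_refl by blast
    then have "lev n p = {x n}" unfolding lev_def by simp
    then show ?thesis
      using that[OF order_refl TM3_F monotone_epi_id] out_edges_singleton[OF TM3_F L_in[OF x(1), of n]]
      by simp
  next
    case True
    then obtain y where y: "(x, y) \<in> E" "x \<noteq> y" by blast
    then have yL: "y \<in> L" unfolding E_iff by blast
    have pxy: "p = {x, y}"
    proof (rule set_eqI)
      fix z show "z \<in> p \<longleftrightarrow> z \<in> {x, y}"
        using E_mate_unique[OF E_sym[OF y(1)] y(2)[symmetric], of z] x y E_refl in_cls_iff by auto
    qed
    obtain m0 where m0: "\<And>k. m0 \<le> k \<Longrightarrow> x k \<noteq> y k" using neq_at_level[OF x(1) yL y(2)] by blast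
    define m where "m = max n m0"
    have nm: "n \<le> m" and ne: "x m \<noteq> y m" using m0 unfolding m_def by auto
    have e: "(x m, y m) \<in> snd (F m)" using y unfolding E_iff by blast
    let ?a = "x m" and ?b = "y m"
    have in_F: "?a \<in> fst (F m)" "?b \<in> fst (F m)" using L_in x yL by auto
    obtain c k h where c: "c \<notin> fst (F m)" and mk: "m \<le> k"
      and B: "TM3 (split_vertex (F m) ?a c {?b})"
      and h: "is_monotone_epi (F k) (split_vertex (F m) ?a c {?b}) h"
      and g: "\<And>v. v \<in> fst (F k) \<Longrightarrow> collapse ?a c (h v) = bond m k v"
      using subdivide[OF e ne] by metis
    let ?B = "split_vertex (F m) ?a c {?b}"
    have nb: "{?b} \<subseteq> neighbours (F m) ?a" using e ne in_F unfolding neighbours_def by auto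
    note sf = split_edge_iff[OF F_tree in_F(1) c nb]
    have cn: "c \<noteq> ?a" "c \<noteq> ?b" using c in_F by auto
    have hy: "h (y k) = ?b"
      using g[OF L_in[OF yL]] bond_L[OF yL mk] ne unfolding collapse_def by (auto split: if_splits)
    have "h (x k) = ?a \<or> h (x k) = c"
      using g[OF L_in[OF x(1)]] bond_L[OF x(1) mk] unfolding collapse_def by (auto split: if_splits)
    moreover have "(h (x k), h (y k)) \<in> snd ?B" using monotone_epiD(2)[OF h] y unfolding E_iff by blast
    \<comment> \<open>After the subdivision \<open>?a\<close> and \<open>?b\<close> are no longer
      adjacent, so \<open>x\<close> has to pass over the new vertex.\<close>
    ultimately have hx: "h (x k) = c" using hy ne cn unfolding sf by auto
    have W: "h ` lev k p = {c, ?b}" unfolding lev_def pxy using hx hy by auto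
    have in_B: "c \<in> fst ?B" "?b \<in> fst ?B" using in_F unfolding split_vertex_def by auto
    \<comment> \<open>The new vertex contributes only its edge to \<open>?a\<close>, and
      \<open>?b\<close> at most two edges besides the one to \<open>c\<close>; together at most
      3.\<close>
    have "out_edges ?B {c, ?b} \<subseteq> insert (c, ?a) (out_edges ?B {?b} - {(?b, c)})"
      using cn c is_graph_in[OF F_graph] unfolding out_edges_def sf by auto
    moreover have "(?b, c) \<in> out_edges ?B {?b}" using cn unfolding out_edges_def sf by auto
    then have "card (out_edges ?B {?b} - {(?b, c)}) \<le> 2"
      using out_edges_singleton[OF B in_B(2)] by (simp add: card_Diff_singleton)
    then have "card (insert (c, ?a) (out_edges ?B {?b} - {(?b, c)})) \<le> 3"
      using card_insert_le_m1[of 3 "out_edges ?B {?b} - {(?b, c)}" "(c, ?a)"] by simp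
    moreover have "finite (insert (c, ?a) (out_edges ?B {?b} - {(?b, c)}))"
      using out_edges_singleton(1)[OF B in_B(2)] by simp
    ultimately have "finite (out_edges ?B (h ` lev k p))" "card (out_edges ?B (h ` lev k p)) \<le> 3"
      unfolding W using finite_subset card_mono le_trans by metis+
    moreover have "h v \<notin> h ` lev k p" if v: "v \<in> fst (F k)" "bond n k v \<notin> lev n p" for v
    proof
      assume "h v \<in> h ` lev k p"
      then have "bond m k v = x m \<or> bond m k v = y m"
        using g[OF v(1)] cn unfolding W collapse_def by (auto split: if_splits)
      moreover have "bond n m (bond m k v) = bond n k v" using bond_comp[OF nm mk] .
      ultimately have "bond n k v = x n \<or> bond n k v = y n" using bond_L[OF x(1) nm] bond_L[OF yL nm] by metis
      then show False using v(2) unfolding lev_def pxy by auto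
    qed
    moreover have "n \<le> k" using nm mk by simp
    ultimately show ?thesis using that[OF _ B h] by blast
  qed
qed

lemma same_component:
  assumes T: "T \<subseteq> fst (F n)" "graph_connected_set (F n) T" and p: "lev n p \<inter> T = {}"
    and u: "u \<in> L" "u n \<in> T" "v \<in> L" "v n \<in> T"
  shows "connected_component_of (subtopology X (topspace X - {p})) (cls u) (cls v)"
proof -
  have "K n T \<subseteq> topspace X - {p}" using p unfolding topspace_X by (auto simp: in_K_iff)
  then have "connectedin (subtopology X (topspace X - {p})) (K n T)"
    using K_connected[OF T] by (simp add: connectedin_subtopology)
  then show ?thesis unfolding connected_component_of_def using cls_in_K u by blast
qed

text \<open>Four components would give four threads off the trace of \<open>p\<close> at a common
  level, to be distributed over at most three outgoing edges of \<open>?W\<close>. Two of them would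
  share an edge, hence a component.\<close>

lemma comps_at_bound:
  assumes p: "p \<in> topspace X"
  shows "finite (comps_at X p) \<and> card (comps_at X p) \<le> 3"
proof (rule ccontr)
  let ?Y = "subtopology X (topspace X - {p})"
  assume neg: "\<not> (finite (comps_at X p) \<and> card (comps_at X p) \<le> 3)"
  obtain \<D> where \<D>: "\<D> \<subseteq> comps_at X p" "finite \<D>" "card \<D> = 4"
  proof (cases "finite (comps_at X p)")
    case True
    then have "4 \<le> card (comps_at X p)" using neg by linarith
    then show ?thesis using that obtain_subset_with_card_n by metis
  next
    case False
    then show ?thesis using that infinite_arbitrarily_large by metis
  qed
  have pX: "p \<in> cls ` L" using p topspace_X by simp
  have "\<exists>u. u \<in> L \<and> cls u \<noteq> p \<and> D = connected_component_of_set ?Y (cls u)" if D: "D \<in> \<D>" for D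
  proof -
    obtain q where q: "q \<in> topspace ?Y" "D = connected_component_of_set ?Y q"
      using D \<D>(1) unfolding comps_at_def connected_components_of_def by blast
    then have "q \<in> cls ` L" "q \<noteq> p" unfolding topspace_subtopology topspace_X by auto
    then show ?thesis using q by blast
  qed
  then obtain u where u: "\<And>D. D \<in> \<D> \<Longrightarrow> u D \<in> L" "\<And>D. D \<in> \<D> \<Longrightarrow> cls (u D) \<noteq> p"
    "\<And>D. D \<in> \<D> \<Longrightarrow> D = connected_component_of_set ?Y (cls (u D))" by metis
  have "\<exists>n. \<forall>k\<ge>n. u D k \<notin> lev k p" if D: "D \<in> \<D>" for D
  proof -
    obtain n where n: "\<And>k. n \<le> k \<Longrightarrow> lev k (cls (u D)) \<inter> lev k p = {}"
      using level_avoid[OF u(1)[OF D] pX u(2)[OF D]] by metis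
    have "u D k \<in> lev k (cls (u D))" for k unfolding lev_def using in_cls_self[OF u(1)[OF D]] by blast
    then show ?thesis using n by blast
  qed
  then obtain N where N: "\<And>D k. D \<in> \<D> \<Longrightarrow> N D \<le> k \<Longrightarrow> u D k \<notin> lev k p" by metis
  define n where "n = Max (N ` \<D>)"
  have un: "u D n \<notin> lev n p" if "D \<in> \<D>" for D
    using N[OF that] Max_ge[of "N ` \<D>" "N D"] that \<D>(2) unfolding n_def by auto
  obtain k B h where nk: "n \<le> k" and B: "TM3 B" and h: "is_monotone_epi (F k) B h"
    and out: "finite (out_edges B (h ` lev k p))" "card (out_edges B (h ` lev k p)) \<le> 3"
    and avoid: "\<And>v. v \<in> fst (F k) \<Longrightarrow> bond n k v \<notin> lev n p \<Longrightarrow> h v \<notin> h ` lev k p"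
    using class_few_out_edges[OF pX, of n] by metis
  let ?W = "h ` lev k p"
  note G = TM3D(2)[OF B] and T = TM3D(1)[OF B]
  have levF: "lev k p \<subseteq> fst (F k)" using lev_subset[OF pX] .
  then have WB: "?W \<subseteq> fst B" using monotone_epi_in[OF h] by blast
  have Wne: "?W \<noteq> {}" using pX in_cls_self unfolding lev_def by blast
  have Wcon: "graph_connected_set B ?W"
    unfolding gcs_iff using monotone_epiD(2)[OF h lev_adjacent[OF pX]] by blast
  have "\<exists>e. e \<in> out_edges B ?W \<and> h (u D k) \<notin> side B (fst e) (snd e)" if D: "D \<in> \<D>" for D
  proof -
    have uF: "u D k \<in> fst (F k)" using L_in[OF u(1)[OF D]] .
    have "h (u D k) \<notin> ?W" using avoid[OF uF] un[OF D] bond_L[OF u(1)[OF D] nk] by simp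
    then obtain a b where "a \<in> ?W" "b \<notin> ?W" "(a, b) \<in> snd B" "h (u D k) \<notin> side B a b"
      using tree_branch[OF T WB Wne monotone_epi_in[OF h uF]] by blast
    then show ?thesis unfolding out_edges_def by (intro exI[of _ "(a, b)"]) simp
  qed
  then obtain e where e: "\<And>D. D \<in> \<D> \<Longrightarrow> e D \<in> out_edges B ?W"
    "\<And>D. D \<in> \<D> \<Longrightarrow> h (u D k) \<notin> side B (fst (e D)) (snd (e D))" by metis
  have "card (e ` \<D>) < card \<D>"
    using card_mono[OF out(1) image_subsetI[of \<D> e, OF e(1)]] out(2) \<D>(3) by simp
  then have "\<not> inj_on e \<D>" using pigeonhole by blast
  then obtain D D' where DD: "D \<in> \<D>" "D' \<in> \<D>" "D \<noteq> D'" "e D = e D'" unfolding inj_on_def by blast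
  obtain a b where ab: "e D = (a, b)" by (cases "e D")
  then have eab: "a \<in> ?W" "b \<notin> ?W" "(a, b) \<in> snd B" using e(1)[OF DD(1)] unfolding out_edges_def by auto
  then have cut: "is_cut B a b (side B a b)" using side_is_cut[OF T eab(3)] by blast
  \<comment> \<open>With \<open>?W\<close> on the near side, the far side pulled back to level
    \<open>k\<close> is a connected set missing the trace of \<open>p\<close>.\<close>
  have "?W \<subseteq> side B a b"
    by (rule cut_traps_connected[OF G cut Wcon eab(1)]) (use cut eab in \<open>auto simp: is_cut_def\<close>)
  moreover have bB: "b \<in> fst B" using is_graph_in[OF G eab(3)] by blast
  let ?T = "{v \<in> fst (F k). h v \<in> fst B - side B a b}"
  have "graph_connected_set (F k) ?T"
    using monotone_epiD(3)[OF h _ cut_compl_connected[OF G tree_connected[OF T] cut bB]] by simp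
  moreover have "h (u D k) \<notin> side B a b" "h (u D' k) \<notin> side B a b"
    using e(2)[OF DD(1)] e(2)[OF DD(2)] unfolding DD(4)[symmetric] ab by simp_all
  then have "u D k \<in> ?T" "u D' k \<in> ?T"
    using L_in[OF u(1)] DD(1,2) monotone_epi_in[OF h] by simp_all
  ultimately have "connected_component_of ?Y (cls (u D)) (cls (u D'))"
    using same_component[of ?T k p "u D" "u D'"] u(1) DD(1,2) by blast
  then have "connected_component_of_set ?Y (cls (u D)) = connected_component_of_set ?Y (cls (u D'))"
    by (simp add: connected_component_of_equiv)
  then show False using u(3) DD by metis
qed

section \<open>Ramification points over every vertex\<close>

lemma two_threads:
  assumes w: "w \<in> fst (F k)"
  obtains u u' where "u \<in> L" "u' \<in> L" "u k = w" "u' k = w" "u \<noteq> u'"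
proof -
  obtain b where b: "(w, b) \<in> snd (F k)" "w \<noteq> b" using TM3_has_neighbour[OF TM3_F w] .
  obtain c m h where c: "c \<notin> fst (F k)" and m: "k \<le> m"
    and h: "is_monotone_epi (F m) (split_vertex (F k) w c {b}) h"
    and g: "\<And>v. v \<in> fst (F m) \<Longrightarrow> collapse w c (h v) = bond k m v"
    using subdivide[OF b] by metis
  have "w \<in> h ` fst (F m)" "c \<in> h ` fst (F m)"
    using monotone_epiD(1)[OF h] w unfolding split_vertex_def by auto
  then obtain v v' where v: "v \<in> fst (F m)" "h v = w" "v' \<in> fst (F m)" "h v' = c" by blast
  obtain u u' where u: "u \<in> L" "u m = v" "u' \<in> L" "u' m = v'"
    using thread_exists[OF v(1)] thread_exists[OF v(3)] by metis
  have "c \<noteq> w" using c w by blast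
  then have "u k = w" "u' k = w"
    using g[OF v(1)] g[OF v(3)] v u bond_L[OF u(1) m] bond_L[OF u(3) m] unfolding collapse_def by auto
  moreover have "u \<noteq> u'" using u v w c by auto
  ultimately show ?thesis using that u by blast
qed

text \<open>Subdivision puts two different threads over \<open>w\<close>, and only one of them can
  be the mate of \<open>z\<close>.\<close>

lemma unrelated_thread:
  assumes w: "w \<in> fst (F k)" and z: "z \<in> L" "z k \<noteq> w"
  obtains u where "u \<in> L" "u k = w" "(u, z) \<notin> E"
proof -
  obtain u u' where u: "u \<in> L" "u' \<in> L" "u k = w" "u' k = w" "u \<noteq> u'" using two_threads[OF w] .
  have "(u, z) \<notin> E \<or> (u', z) \<notin> E"
    using E_mate_unique[of u z u'] E_sym u z by metis
  then show ?thesis using that u by blast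
qed

text \<open>The interval condition is asked only from level \<open>k\<close> on, because the threads
  to which this applies are adjusted within fibres of that level.\<close>

lemma three_branches_ramification:
  fixes x :: "nat \<Rightarrow> nat \<Rightarrow> nat"
  assumes x: "\<And>i. i < 3 \<Longrightarrow> x i \<in> L" "\<And>i. i < 3 \<Longrightarrow> (x i, z) \<notin> E" and z: "z \<in> L"
    and I: "\<And>i j m. i < j \<Longrightarrow> j < 3 \<Longrightarrow> k \<le> m \<Longrightarrow> z m \<in> interval (F m) (x i m) (x j m)"
  shows "cls z \<in> ramification_points X"
proof -
  let ?Y = "subtopology X (topspace X - {cls z})"
  let ?f = "\<lambda>i. connected_component_of_set ?Y (cls (x i))"
  have zX: "cls z \<in> topspace X" using z unfolding topspace_X by blast
  have xY: "cls (x i) \<in> topspace ?Y" if "i < 3" for i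
    using x[OF that] z cls_eq_iff[of "x i" z] unfolding topspace_subtopology topspace_X by auto
  have ne: "?f i \<noteq> ?f j" if ij: "i < j" "j < 3" for i j
  proof
    assume "?f i = ?f j"
    then have "connected_component_of ?Y (cls (x i)) (cls (x j))"
      using xY ij connected_component_of_refl[of ?Y "cls (x j)"] by auto
    then obtain S where S: "connectedin ?Y S" "cls (x i) \<in> S" "cls (x j) \<in> S"
      unfolding connected_component_of_def by blast
    then have "connectedin X S" "cls z \<notin> S" unfolding connectedin_subtopology by auto
    then show False
      using thread_in_intervals_separates[of "x i" "x j" z k S] x ij z I[OF ij] S by auto
  qed
  have "?f ` {..<3} \<subseteq> comps_at X (cls z)"
    unfolding comps_at_def connected_components_of_def using xY by blast
  moreover have "inj_on ?f {..<3}"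
    by (rule linorder_inj_onI') (use ne in auto)
  then have "card (?f ` {..<3}) = 3" by (simp add: card_image)
  ultimately have "3 \<le> card (comps_at X (cls z))"
    using comps_at_bound[OF zX] card_mono by metis
  then show ?thesis using zX unfolding ramification_points_def by blast
qed

text \<open>Each level has a median, and every vertex carries a thread. By
  \<open>interval_image\<close> the sets of threads passing through medians decrease with the level,
  so compactness yields one thread for all levels.\<close>

lemma median_thread:
  assumes x: "x \<in> L" "y \<in> L" "w \<in> L"
  obtains z where "z \<in> L" "\<And>m. z m \<in> interval (F m) (x m) (y m)"
    "\<And>m. z m \<in> interval (F m) (x m) (w m)" "\<And>m. z m \<in> interval (F m) (y m) (w m)"
proof -
  let ?M = "\<lambda>m. interval (F m) (x m) (y m) \<inter> interval (F m) (x m) (w m) \<inter> interval (F m) (y m) (w m)"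
  have "\<exists>z. \<forall>m. z \<in> {z \<in> L. z m \<in> ?M m}"
  proof (rule compact_decreasing_Inter[OF compact_L cylinder_closed])
    show "{z \<in> L. z m \<in> ?M m} \<noteq> {}" for m
    proof -
      obtain v where v: "v \<in> ?M m"
        using median_exists[OF F_tree L_in[OF x(1)] L_in[OF x(2)] L_in[OF x(3)]] by blast
      then have "v \<in> fst (F m)"
        using intervalD[OF _ subset_refl tree_connected[OF F_tree] L_in[OF x(1)] L_in[OF x(2)]] by blast
      then show ?thesis using thread_exists v by blast
    qed
    show "{z \<in> L. z (Suc m) \<in> ?M (Suc m)} \<subseteq> {z \<in> L. z m \<in> ?M m}" for m
    proof
      fix z assume z: "z \<in> {z \<in> L. z (Suc m) \<in> ?M (Suc m)}"
      have "z m \<in> interval (F m) (s m) (t m)"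
        if "s \<in> L" "t \<in> L" "z (Suc m) \<in> interval (F (Suc m)) (s (Suc m)) (t (Suc m))" for s t
        using interval_image[OF step_epi that(3) L_in[OF that(1)] L_in[OF that(2)]]
          L_step[OF that(1)] L_step[OF that(2)] L_step[of z m] z by simp
      then show "z \<in> {z \<in> L. z m \<in> ?M m}" using z x by blast
    qed
  qed blast
  then show ?thesis using that by blast
qed

text \<open>The vertex \<open>v\<close> may be an end or already have order 3. The subdividing
  vertex \<open>c\<close> has order exactly 2, so it always has room for a leaf \<open>d\<close> and
  becomes the centre of a tripod with legs \<open>v\<close>, \<open>b\<close>,
  \<open>d\<close>.\<close>

lemma tripod_over:
  assumes v: "v \<in> fst (F n)"
  obtains k h B c w where "n \<le> k" "TM3 B" "is_monotone_epi (F k) B h"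
    "\<And>u. u \<in> fst (F k) \<Longrightarrow> h u = c \<Longrightarrow> bond n k u = v"
    "\<And>i. i < (3 :: nat) \<Longrightarrow> (c, w i) \<in> snd B" "\<And>i. i < (3 :: nat) \<Longrightarrow> w i \<noteq> c" "inj_on w {..<3 :: nat}"
proof -
  obtain b where b: "(v, b) \<in> snd (F n)" "v \<noteq> b" using TM3_has_neighbour[OF TM3_F v] .
  have bF: "b \<in> fst (F n)" using is_graph_in[OF F_graph b(1)] by blast
  obtain c where c: "c \<notin> fst (F n)" using TM3_fresh[OF TM3_F] .
  let ?B = "split_vertex (F n) v c {b}"
  note B = TM3_subdivide[OF TM3_F b c]
  obtain d where d: "d \<notin> fst ?B" using TM3_fresh[OF B(1)] .
  let ?C = "split_vertex ?B c d {}"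
  have nb: "{b} \<subseteq> neighbours (F n) v" using b bF unfolding neighbours_def by auto
  have cB: "c \<in> fst ?B" unfolding split_vertex_def by simp
  have "neighbours ?B c = {v, b}" using split_neighbours_new[OF F_tree v c nb] by simp
  then have two: "card (neighbours ?B c) = 2" using b(2) by simp
  have C: "TM3 ?C" by (rule TM3_split[OF B(1) cB d]) (simp_all add: two)
  have "is_monotone_epi ?C ?B (collapse c d)" using split_monotone_epi[OF TM3D(1)[OF B(1)] cB d] by simp
  then have g: "is_monotone_epi ?C (F n) (\<lambda>x. collapse v c (collapse c d x))"
    using monotone_epi_comp B(2) by blast
  obtain k h where k: "n \<le> k" and h: "is_monotone_epi (F k) ?C h"
    and gh: "\<And>u. u \<in> fst (F k) \<Longrightarrow> collapse v c (collapse c d (h u)) = bond n k u"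
    using extension[OF C g] by metis
  have dist: "d \<noteq> c" "d \<noteq> v" "d \<noteq> b" "c \<noteq> v" "c \<noteq> b" using d c v bF unfolding split_vertex_def by auto
  define w where "w i = (if i = 0 then v else if i = 1 then b else d)" for i :: nat
  have "(c, w i) \<in> snd ?C" for i
    unfolding w_def split_vertex_def using dist by auto
  moreover have "w i \<noteq> c" for i using dist unfolding w_def by auto
  moreover have "inj_on w {..<3}" using dist b(2) unfolding w_def inj_on_def by auto
  moreover have "bond n k u = v" if "u \<in> fst (F k)" "h u = c" for u
    using gh[OF that(1)] that(2) dist unfolding collapse_def by auto
  ultimately show ?thesis using that[OF k C h] by blast
qed

text \<open>Threads through the three legs of a tripod have a median thread, which must pass over
  the centre \<open>c\<close>; the whole fibre of \<open>c\<close> lies over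
  \<open>v\<close>.\<close>

lemma ramification_point_over:
  assumes v: "v \<in> fst (F n)"
  obtains p where "p \<in> ramification_points X" "p \<in> K n {v}"
proof -
  obtain k h B c w where k: "n \<le> k" and B: "TM3 B" and h: "is_monotone_epi (F k) B h"
    and hc: "\<And>u. u \<in> fst (F k) \<Longrightarrow> h u = c \<Longrightarrow> bond n k u = v"
    and w: "\<And>i. i < (3 :: nat) \<Longrightarrow> (c, w i) \<in> snd B" "\<And>i. i < (3 :: nat) \<Longrightarrow> w i \<noteq> c"
    and winj: "inj_on w {..<3 :: nat}"
    using tripod_over[OF v] by metis
  note G = TM3D(2)[OF B]
  have "\<exists>x. x \<in> L \<and> h (x k) = w i" if i: "i < 3" for i
  proof -
    have "w i \<in> h ` fst (F k)" using monotone_epiD(1)[OF h] is_graph_in[OF G w(1)[OF i]] by blast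
    then obtain u where "u \<in> fst (F k)" "h u = w i" by auto
    then show ?thesis using thread_exists by metis
  qed
  then obtain x where x: "\<And>i. i < 3 \<Longrightarrow> x i \<in> L" "\<And>i. i < 3 \<Longrightarrow> h (x i k) = w i" by metis
  obtain z where z: "z \<in> L" and "\<And>m. z m \<in> interval (F m) (x 0 m) (x 1 m)"
    "\<And>m. z m \<in> interval (F m) (x 0 m) (x 2 m)" "\<And>m. z m \<in> interval (F m) (x 1 m) (x 2 m)"
    using median_thread[of "x 0" "x 1" "x 2"] x(1) by auto
  moreover have "i = 0 \<and> j = 1 \<or> i = 0 \<and> j = 2 \<or> i = 1 \<and> j = 2" if "i < j" "j < 3" for i j :: nat
    using that by linarith
  ultimately have I: "z m \<in> interval (F m) (x i m) (x j m)" if "i < j" "j < 3" for i j m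
    using that by metis
  have hz: "h (z k) \<in> {w i, c, w j}" if ij: "i < j" "j < 3" for i j
  proof -
    have i: "i < 3" using ij by simp
    have "graph_connected_set B {w i, c, w j}"
      using gcs_insert_edge[OF G gcs_edge[OF G w(1)[OF ij(2)]] _ w(1)[OF i]] by simp
    moreover have "h (z k) \<in> interval B (w i) (w j)"
      using interval_image[OF h I[OF ij]] x i ij(2) L_in by metis
    moreover have "{w i, c, w j} \<subseteq> fst B" using is_graph_in[OF G w(1)] i ij(2) by blast
    ultimately show ?thesis using intervalD[of "h (z k)" B "w i" "w j"] by blast
  qed
  have wne: "w 0 \<noteq> w 1" "w 0 \<noteq> w 2" "w 1 \<noteq> w 2" using inj_onD[OF winj] by force+
  \<comment> \<open>The centre is the only vertex common to the three sets
    \<open>{w i, c, w j}\<close>.\<close>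
  have hzc: "h (z k) = c" using hz[of 0 1] hz[of 0 2] hz[of 1 2] wne by auto
  have zx: "z k \<noteq> x i k" if "i < 3" for i using hzc x(2)[OF that] w(2)[OF that] by metis
  txt \<open>Some \<open>x i\<close> may be adjacent to \<open>z\<close>; moving it within the fibre of its vertex at level \<open>k\<close> avoids
    this and keeps \<open>z\<close> in the intervals.\<close>
  have "\<exists>y. y \<in> L \<and> y k = x i k \<and> (y, z) \<notin> E" if i: "i < 3" for i
    using unrelated_thread[OF L_in[OF x(1)[OF i]] z zx[OF i]] by metis
  then obtain y where y: "\<And>i. i < 3 \<Longrightarrow> y i \<in> L" "\<And>i. i < 3 \<Longrightarrow> y i k = x i k" "\<And>i. i < 3 \<Longrightarrow> (y i, z) \<notin> E"
    by metis
  have "z m \<in> interval (F m) (y i m) (y j m)" if ij: "i < j" "j < 3" and m: "k \<le> m" for i j m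
    unfolding interval_def
  proof (intro CollectI allI impI)
    fix S assume S: "S \<subseteq> fst (F m)" "graph_connected_set (F m) S" "y i m \<in> S" "y j m \<in> S"
    have i: "i < 3" using ij by simp
    \<comment> \<open>Adding to \<open>S\<close> the two fibres, each holding an old thread and its
      replacement, gives a connected set through the old threads, hence containing
      \<open>z m\<close>. As \<open>z m\<close> is outside both fibres, it was in
      \<open>S\<close>.\<close>
    let ?A = "\<lambda>l. {u \<in> fst (F m). bond k m u \<in> {x l k}}"
    have A: "graph_connected_set (F m) (?A l)" "x l m \<in> ?A l" "y l m \<in> ?A l" "z m \<notin> ?A l" if "l < 3" for l
      using monotone_epiD(3)[OF bond_epi[OF m] _ gcs_singleton] L_in[OF x(1)[OF that]] L_in[OF y(1)[OF that]]
        bond_L[OF x(1)[OF that] m] bond_L[OF y(1)[OF that] m] bond_L[OF z m] y(2)[OF that] zx[OF that] by auto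
    have "graph_connected_set (F m) (S \<union> ?A i)"
      using gcs_Un[OF F_graph S(2) A(1)[OF i] S(3) A(3)[OF i]] S by blast
    then have "graph_connected_set (F m) (S \<union> ?A i \<union> ?A j)"
      using gcs_Un[OF F_graph _ A(1)[OF ij(2)] _ A(3)[OF ij(2)]] S by blast
    then have "z m \<in> S \<union> ?A i \<union> ?A j"
      using intervalD[OF I[OF ij, of m], of "S \<union> ?A i \<union> ?A j"] A(2)[OF i] A(2)[OF ij(2)] S(1) by blast
    then show "z m \<in> S" using A(4)[OF i] A(4)[OF ij(2)] by blast
  qed
  then have "cls z \<in> ramification_points X"
    using three_branches_ramification[of y z k] y z by blast
  moreover have "z n = v" using hc[OF L_in[OF z] hzc] bond_L[OF z k] by simp
  then have "cls z \<in> K n {v}" using cls_in_K z by blast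
  ultimately show ?thesis using that by blast
qed

lemma ramification_dense: "X closure_of (ramification_points X) = topspace X"
proof (intro subset_antisym closure_of_subset_topspace subsetI)
  fix p assume p: "p \<in> topspace X"
  have "\<exists>q\<in>ramification_points X. q \<in> U" if U: "p \<in> U" "openin X U" for U
  proof -
    obtain n where n: "K n (lev n p) \<subseteq> U" using K_lev_small[OF U] .
    obtain x where x: "x \<in> L" "p = cls x" using p unfolding topspace_X by blast
    obtain q where q: "q \<in> ramification_points X" "q \<in> K n {x n}"
      using ramification_point_over[OF L_in[OF x(1)]] by blast
    moreover have "{x n} \<subseteq> lev n p" unfolding lev_def using x in_cls_self by blast
    ultimately show ?thesis using n K_mono by blast
  qed
  then show "p \<in> X closure_of (ramification_points X)" unfolding in_closure_of using p by blast
qed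

theorem wazewski_X: "wazewski_D3 X"
  unfolding wazewski_D3_def
proof (intro conjI ballI dendrite_X ramification_dense)
  fix p assume p: "p \<in> ramification_points X"
  then have b: "finite (comps_at X p) \<and> card (comps_at X p) \<le> 3"
    using comps_at_bound unfolding ramification_points_def by blast
  then show "finite (comps_at X p)" by blast
  show "card (comps_at X p) = 3" using b p unfolding ramification_points_def by auto
qed

end

theorem theorem3p15:
  fixes F :: "nat \<Rightarrow> fgraph" and \<alpha> :: "nat \<Rightarrow> nat \<Rightarrow> nat"
  assumes "is_proj_fraisse_limit_TM3 F \<alpha>"
  shows "wazewski_D3 (realization F \<alpha>)"
proof -
  interpret fraisse_limit F \<alpha> by unfold_locales (rule assms)
  show ?thesis by (rule wazewski_X)
qed

end
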